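(* Let $\mathcal{G}$ be a comeager subset of $2^\omega$. Then there exists a weakly $2$-random $X\in 2^\omega$ that computes (i.e., is Turing above) some $Y\in\mathcal{G}$.
   Context: $2^\omega$ is the Cantor space of infinite binary sequences with the product topology, and $\mu$ is the Lebesgue (uniform) measure on it, determined by $\mu([\sigma])=2^{-|\sigma|}$ for every finite binary string $\sigma$, where $[\sigma]$ is the set of $X\in 2^\omega$ having $\sigma$ as a prefix. A subset of $2^\omega$ is comeager if it contains a countable intersection of dense open sets. $X\in 2^\omega$ is weakly $2$-random if it does not belong to any (lightface) $\Pi^0_2$ set of $\mu$-measure $0$, where a $\Pi^0_2$ set is a set of the form $\bigcap_k \mathcal{U}_k$ for a sequence $(\mathcal{U}_k)_{k\in\omega}$ of uniformly effectively open sets (an effectively open set being one of the form $\bigcup_{\sigma\in S}[\sigma]$ for a computably enumerable set $S$ of strings). *)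

theory Defs
  imports "HOL-Probability.Probability" "HOL-Library.Nat_Bijection"
begin

section \<open>Cantor space\<close>

text \<open>
  The type \<^typ>\<open>nat \<Rightarrow> bool\<close> carries the library's product topology, with \<^typ>\<open>bool\<close> discrete.
  A finite binary string is a \<^typ>\<open>bool list\<close>.
\<close>

type_synonym cantor = "nat \<Rightarrow> bool"

definition cylinder :: "bool list \<Rightarrow> cantor set" where
  "cylinder \<sigma> = {X. \<forall>i<length \<sigma>. X i = \<sigma> ! i}"

definition cantor_measure :: "cantor measure" where
  "cantor_measure = (\<Pi>\<^sub>M i\<in>UNIV. measure_pmf (bernoulli_pmf (1/2)))"

definition comeager :: "'a::topological_space set \<Rightarrow> bool" where
  "comeager G \<longleftrightarrow>
     (\<exists>\<D>. countable \<D> \<and> (\<forall>D\<in>\<D>. open D \<and> closure D = UNIV) \<and> \<Inter>\<D> \<subseteq> G)"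

section \<open>Computability relative to an oracle\<close>

text \<open>
  Programs for the partial recursive functions of one argument relative to an oracle, with
  tuples coded by the (primitive recursive) Cantor pairing \<^const>\<open>prod_encode\<close>. The relation
  \<open>run A p x y\<close> says that \<open>p\<close> with oracle \<open>A\<close> halts on input \<open>x\<close> with output \<open>y\<close>.
\<close>

datatype prog =
    PZero | PSucc | PFst | PSnd | POracle
  | PPair prog prog
  | PComp prog prog
  | PRec prog prog
  | PMin prog

inductive run :: "cantor \<Rightarrow> prog \<Rightarrow> nat \<Rightarrow> nat \<Rightarrow> bool" for A :: cantor where
  zero: "run A PZero x 0"
| succ: "run A PSucc x (Suc x)"
| fst: "run A PFst (prod_encode (x, y)) x"
| snd: "run A PSnd (prod_encode (x, y)) y"
| query: "run A POracle x (of_bool (A x))"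
| pair: "run A p x y \<Longrightarrow> run A q x z \<Longrightarrow> run A (PPair p q) x (prod_encode (y, z))"
| comp: "run A q x y \<Longrightarrow> run A p y z \<Longrightarrow> run A (PComp p q) x z"
| rec_0: "run A p x y \<Longrightarrow> run A (PRec p q) (prod_encode (x, 0)) y"
| rec_Suc: "run A (PRec p q) (prod_encode (x, n)) y \<Longrightarrow>
    run A q (prod_encode (x, prod_encode (n, y))) z \<Longrightarrow>
    run A (PRec p q) (prod_encode (x, Suc n)) z"
| min: "run A p (prod_encode (x, n)) 0 \<Longrightarrow>
    (\<And>i. i < n \<Longrightarrow> \<exists>y>0. run A p (prod_encode (x, i)) y) \<Longrightarrow>
    run A (PMin p) x n"

lemma run_deterministic:
  assumes "run A p x y" "run A p x z"
  shows "y = z"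
  using assms
proof (induction arbitrary: z rule: run.induct)
  case (min p x n)
  from min.prems obtain "run A p (prod_encode (x, z)) 0"
      and less: "\<And>i. i < z \<Longrightarrow> \<exists>y>0. run A p (prod_encode (x, i)) y"
    by (auto elim: run.cases)
  with min.IH show ?case
    by (metis less_irrefl linorder_neqE_nat)
next
  case (rec_0 p x y q)
  from rec_0.prems show ?case
    by cases (use rec_0.IH in auto)
next
  case (rec_Suc p q x n y z')
  from rec_Suc.prems show ?case
    by cases (use rec_Suc.IH in auto)
next
  case (pair p x y q z')
  from pair.prems show ?case
    by cases (use pair.IH in auto)
next
  case (comp q x y p z')
  from comp.prems show ?case
    by cases (use comp.IH in auto)
qed (auto elim: run.cases)

text \<open>\<open>computes X Y\<close>: the sequence \<open>Y\<close> is Turing reducible to the sequence \<open>X\<close>.\<close>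

definition computes :: "cantor \<Rightarrow> cantor \<Rightarrow> bool" where
  "computes X Y \<longleftrightarrow> (\<exists>p. \<forall>n. run X p n (of_bool (Y n)))"

definition string_code :: "bool list \<Rightarrow> nat" where
  "string_code \<sigma> = list_encode (map of_bool \<sigma>)"

text \<open>
  A sequence of sets of strings is uniformly computably enumerable if a single program with the
  empty oracle halts on exactly the (codes of) pairs \<open>(k, \<sigma>)\<close> with \<open>\<sigma> \<in> S k\<close>.
\<close>

definition uniformly_ce :: "(nat \<Rightarrow> bool list set) \<Rightarrow> bool" where
  "uniformly_ce S \<longleftrightarrow>
     (\<exists>p. \<forall>k \<sigma>. \<sigma> \<in> S k \<longleftrightarrow> (\<exists>y. run (\<lambda>_. False) p (prod_encode (k, string_code \<sigma>)) y))"

section \<open>Weak 2-randomness\<close>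

definition uniformly_effectively_open :: "(nat \<Rightarrow> cantor set) \<Rightarrow> bool" where
  "uniformly_effectively_open U \<longleftrightarrow>
     (\<exists>S. uniformly_ce S \<and> (\<forall>k. U k = (\<Union>\<sigma>\<in>S k. cylinder \<sigma>)))"

definition Pi02 :: "cantor set \<Rightarrow> bool" where
  "Pi02 A \<longleftrightarrow> (\<exists>U. uniformly_effectively_open U \<and> A = (\<Inter>k. U k))"

definition weakly_2_random :: "cantor \<Rightarrow> bool" where
  "weakly_2_random X \<longleftrightarrow> (\<forall>A. Pi02 A \<and> A \<in> null_sets cantor_measure \<longrightarrow> X \<notin> A)"

text \<open>
  The following facts pin down the measure, and show that \<^const>\<open>null_sets\<close> loses no
  \<open>\<Pi>\<^sup>0\<^sub>2\<close> set for want of measurability.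
\<close>

lemma cylinder_eq: "cylinder \<sigma> = {X \<in> space cantor_measure. \<forall>i\<in>{..<length \<sigma>}. X i \<in> {\<sigma> ! i}}"
  by (auto simp: cylinder_def cantor_measure_def space_PiM)

lemma sets_cylinder [measurable]: "cylinder \<sigma> \<in> sets cantor_measure"
proof -
  have "{X \<in> space cantor_measure. X i \<in> {\<sigma> ! i}} \<in> sets cantor_measure" for i
    unfolding cantor_measure_def
    by (rule measurable_sets_Collect[OF measurable_component_singleton]) auto
  then show ?thesis
    unfolding cylinder_eq by (intro sets.sets_Collect_finite_All) auto
qed

lemma emeasure_cylinder: "emeasure cantor_measure (cylinder \<sigma>) = ennreal ((1/2) ^ length \<sigma>)"
proof -
  interpret product_prob_space "\<lambda>_::nat. measure_pmf (bernoulli_pmf (1/2))" UNIV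
    by unfold_locales
  have "emeasure (measure_pmf (bernoulli_pmf (1/2))) {b} = ennreal (1/2)" for b
    by (cases b) (simp_all add: emeasure_pmf_single)
  then have "emeasure cantor_measure (cylinder \<sigma>) = ennreal (1/2) ^ length \<sigma>"
    unfolding cylinder_eq unfolding cantor_measure_def
    by (subst emeasure_PiM_Collect) simp_all
  then show ?thesis
    by (simp only: ennreal_power)
qed

lemma sets_Pi02:
  assumes "Pi02 A"
  shows "A \<in> sets cantor_measure"
proof -
  from assms obtain S :: "nat \<Rightarrow> bool list set" where "A = (\<Inter>k. \<Union>\<sigma>\<in>S k. cylinder \<sigma>)"
    by (auto simp: Pi02_def uniformly_effectively_open_def)
  then show ?thesis
    by (auto intro!: sets.countable_INT' sets.countable_UN')
qed

end

theory Submission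
  imports Defs
begin

text \<open>
  A single online decoder reads \<open>X\<close> and writes \<open>Y\<close>; the input \<open>X\<close> is built against it by finite
  extension. To avoid a null set \<open>\<Inter>k. V k\<close> with \<open>V\<close> decreasing, \<open>X\<close> has to leave some \<open>V k\<close> of
  small measure. The suitable \<open>k\<close> cannot be told to the decoder in advance, so the decoder guesses
  \<open>k = 0, 1, \<dots>\<close> and changes its guess when the measure of \<open>V k\<close> is seen to be too large.
  Inside the effectively closed set given by the correct guesses, which has a known positive lower bound
  on its density, arbitrary strings can be coded as in the Kucera-Gacs theorem: the
  bit is whether \<open>X\<close> follows the leftmost or the rightmost sufficiently dense extension of a given
  length. A wrong guess makes the decoder write garbage, but only finitely much, and afterwards the
  output can still be steered into the next dense open set. This alternates between the dense open sets
  and the null \<open>\<Pi>\<^sup>0\<^sub>2\<close> sets.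
\<close>

section \<open>Functions computable in an oracle\<close>

text \<open>The decoder has no access to the dense open sets and cannot tell which
  \<open>Pi02\<close> sets are null, so both kinds of information travel inside \<open>X\<close>:
  output bits are sent literally, and the index of a program is sent only if its set really is null.
  The number \<open>k\<close> cannot be sent in the same way, since announcing it lengthens the
  prefix, and a longer prefix has smaller measure and may need a larger \<open>k\<close>. Guessing
  upwards works because lack of density shows at a finite stage. All losses are counted in an
  exponent \<open>d\<close>: inside the cylinder of a prefix of length \<open>m\<close>, the closed
  set keeps measure at least \<open>1 / 2 ^ (m + d)\<close>. Each transmitted symbol adds one to
  \<open>d\<close>, and each requirement one more. Garbage is the reason for asking only for some
  member of a comeager set: it would spoil a prescribed \<open>Y\<close>, but every finite output
  extends into every dense open set.\<close>

definition pfst :: "nat \<Rightarrow> nat" where "pfst z = fst (prod_decode z)"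
definition psnd :: "nat \<Rightarrow> nat" where "psnd z = snd (prod_decode z)"

lemma pfst_encode [simp]: "pfst (prod_encode (a, b)) = a"
  and psnd_encode [simp]: "psnd (prod_encode (a, b)) = b"
  and encode_pfst_psnd [simp]: "prod_encode (pfst z, psnd z) = z"
  by (simp_all add: pfst_def psnd_def)

text \<open>Makes \<open>0\<close>, the empty stack, its own tail.\<close>

lemma pfst_0 [simp]: "pfst 0 = 0" and psnd_0 [simp]: "psnd 0 = 0"
  by (simp_all add: pfst_def psnd_def prod_decode_def prod_decode_aux.simps)

definition computable :: "cantor \<Rightarrow> (nat \<Rightarrow> nat) \<Rightarrow> bool" where
  "computable A f \<longleftrightarrow> (\<exists>p. \<forall>x. run A p x (f x))"

definition decidable :: "cantor \<Rightarrow> (nat \<Rightarrow> bool) \<Rightarrow> bool" where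
  "decidable A P \<longleftrightarrow> computable A (\<lambda>x. of_bool (P x))"

named_theorems computable_intros

lemma run_pfst: "run A PFst z (pfst z)" and run_psnd: "run A PSnd z (psnd z)"
  by (metis encode_pfst_psnd run.fst, metis encode_pfst_psnd run.snd)

lemma computable_compose: "computable A f \<Longrightarrow> computable A g \<Longrightarrow> computable A (\<lambda>x. f (g x))"
  unfolding computable_def by (meson run.comp)

lemma decidable_compose: "decidable A P \<Longrightarrow> computable A g \<Longrightarrow> decidable A (\<lambda>x. P (g x))"
  unfolding decidable_def by (rule computable_compose)

lemma computable_Suc [computable_intros]: "computable A f \<Longrightarrow> computable A (\<lambda>x. Suc (f x))"
  by (rule computable_compose[of A Suc]) (auto simp: computable_def intro: run.succ)

lemma computable_pfst [computable_intros]: "computable A f \<Longrightarrow> computable A (\<lambda>x. pfst (f x))"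
  by (rule computable_compose[of A pfst]) (auto simp: computable_def intro: run_pfst)

lemma computable_psnd [computable_intros]: "computable A f \<Longrightarrow> computable A (\<lambda>x. psnd (f x))"
  by (rule computable_compose[of A psnd]) (auto simp: computable_def intro: run_psnd)

lemma computable_pair [computable_intros]:
  "computable A f \<Longrightarrow> computable A g \<Longrightarrow> computable A (\<lambda>x. prod_encode (f x, g x))"
  unfolding computable_def by (meson run.pair)

lemma computable_id [computable_intros]: "computable A (\<lambda>x. x)"
proof -
  have "run A (PPair PFst PSnd) x x" for x
    by (metis encode_pfst_psnd run.pair run_pfst run_psnd)
  then show ?thesis unfolding computable_def by blast
qed

lemma computable_const [computable_intros]: "computable A (\<lambda>x. n)"
proof (induction n)
  case 0
  show ?case unfolding computable_def by (meson run.zero)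
next
  case (Suc n)
  then show ?case by (rule computable_Suc)
qed

text \<open>\<open>PRec\<close> hands the unchanged argument to every round, so the step function
  may depend on it; the three arguments of \<open>H\<close> arrive as a nested pair.\<close>

lemma computable_rec [computable_intros]:
  assumes "computable A g" "computable A (\<lambda>z. H (pfst z) (pfst (psnd z)) (psnd (psnd z)))" "computable A n"
  shows "computable A (\<lambda>x. rec_nat (g x) (H x) (n x))"
proof -
  obtain p where p: "\<And>x. run A p x (g x)" using assms(1) by (auto simp: computable_def)
  obtain q where q: "\<And>z. run A q z (H (pfst z) (pfst (psnd z)) (psnd (psnd z)))"
    using assms(2) by (auto simp: computable_def)
  have *: "run A (PRec p q) (prod_encode (x, i)) (rec_nat (g x) (H x) i)" for x i
  proof (induction i)
    case 0
    show ?case using p by (auto intro: run.rec_0)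
  next
    case (Suc i)
    show ?case
      using run.rec_Suc[OF Suc q] by simp
  qed
  have "computable A (\<lambda>z. rec_nat (g (pfst z)) (H (pfst z)) (psnd z))"
    unfolding computable_def by (rule exI[of _ "PRec p q"]) (metis * encode_pfst_psnd)
  from computable_compose[OF this computable_pair[OF computable_id assms(3)]] show ?thesis by simp
qed

text \<open>Each operation is brought into the shape of \<open>computable_rec\<close>: a conditional
  is a recursion over a truth value, and parity feeds the halving in
  \<open>rec_half\<close>.\<close>

lemma rec_add: "rec_nat m (\<lambda>_ r. Suc r) n = m + n"
  and rec_mult: "rec_nat 0 (\<lambda>_ r. r + m) n = n * m"
  and rec_pred: "rec_nat 0 (\<lambda>i _. i) n = n - 1"
  and rec_if: "rec_nat a (\<lambda>_ _. b) (of_bool P) = (if P then b else a)"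
  and rec_parity: "rec_nat 0 (\<lambda>_ r. 1 - r) n = n mod 2"
  for m n a b :: nat
proof -
  show "rec_nat 0 (\<lambda>_ r. 1 - r) n = n mod 2"
    by (induction n) (simp_all, presburger)
  show "rec_nat 0 (\<lambda>i _. i) n = n - 1"
    by (cases n) simp_all
  show "rec_nat m (\<lambda>_ r. Suc r) n = m + n" and "rec_nat 0 (\<lambda>_ r. r + m) n = n * m"
    by (induction n) simp_all
  show "rec_nat a (\<lambda>_ _. b) (of_bool P) = (if P then b else a)"
    by simp
qed

lemma computable_add [computable_intros]: "computable A f \<Longrightarrow> computable A g \<Longrightarrow> computable A (\<lambda>x. f x + g x)"
  unfolding rec_add[symmetric] by (intro computable_intros)

lemma computable_mult [computable_intros]:
  assumes "computable A f" "computable A g" shows "computable A (\<lambda>x. f x * g x)"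
  unfolding rec_mult[symmetric]
  by (intro computable_intros assms computable_compose[OF assms(2)])

lemma rec_diff: "rec_nat m (\<lambda>_ r. r - 1) n = m - n" for m :: nat
  by (induction n) simp_all

lemma computable_diff [computable_intros]:
  assumes "computable A f" "computable A g" shows "computable A (\<lambda>x. f x - g x)"
proof -
  have pred: "computable A h \<Longrightarrow> computable A (\<lambda>x. h x - 1)" for h
    unfolding rec_pred[symmetric] by (intro computable_intros)
  have "computable A (\<lambda>x. rec_nat (f x) (\<lambda>_ r. r - 1) (g x))"
    by (intro computable_intros pred assms)
  then show ?thesis by (simp only: rec_diff)
qed

lemma rec_power: "rec_nat 1 (\<lambda>_ r. r * m) n = m ^ n" for m :: nat
  by (induction n) simp_all

lemma computable_power [computable_intros]:
  assumes "computable A f" "computable A g" shows "computable A (\<lambda>x. f x ^ g x)"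
  unfolding rec_power[symmetric] by (intro computable_intros assms computable_compose[OF assms(1)])

lemma computable_of_bool [computable_intros]: "decidable A P \<Longrightarrow> computable A (\<lambda>x. of_bool (P x))"
  by (simp add: decidable_def)

lemma computable_if [computable_intros]:
  assumes "decidable A P" "computable A f" "computable A g" shows "computable A (\<lambda>x. if P x then f x else g x)"
  unfolding rec_if[symmetric] by (intro computable_intros assms computable_compose[OF assms(2)])

lemma decidable_not [computable_intros]: "decidable A P \<Longrightarrow> decidable A (\<lambda>x. \<not> P x)"
proof -
  assume "decidable A P"
  then have "computable A (\<lambda>x. if P x then 0 else 1)" by (intro computable_intros)
  moreover have "(\<lambda>x. if P x then 0 else 1) = (\<lambda>x. of_bool (\<not> P x) :: nat)" by auto
  ultimately show ?thesis by (simp only: decidable_def)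
qed

lemma decidable_conj [computable_intros]: "decidable A P \<Longrightarrow> decidable A Q \<Longrightarrow> decidable A (\<lambda>x. P x \<and> Q x)"
  unfolding decidable_def of_bool_conj by (intro computable_intros) (simp_all add: decidable_def)

lemma decidable_disj [computable_intros]:
  assumes "decidable A P" "decidable A Q" shows "decidable A (\<lambda>x. P x \<or> Q x)"
proof -
  have "decidable A (\<lambda>x. \<not> (\<not> P x \<and> \<not> Q x))" by (intro computable_intros assms)
  then show ?thesis by simp
qed

lemma decidable_imp [computable_intros]: "decidable A P \<Longrightarrow> decidable A Q \<Longrightarrow> decidable A (\<lambda>x. P x \<longrightarrow> Q x)"
  unfolding imp_conv_disj by (intro computable_intros)

lemma decidable_le [computable_intros]:
  assumes "computable A f" "computable A g" shows "decidable A (\<lambda>x. f x \<le> g x)"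
proof -
  have "of_bool (f x \<le> g x) = 1 - (f x - g x)" for x by simp
  then show ?thesis unfolding decidable_def by (simp only:) (intro computable_intros assms)
qed

lemma decidable_less [computable_intros]: "computable A f \<Longrightarrow> computable A g \<Longrightarrow> decidable A (\<lambda>x. f x < g x)"
  unfolding Suc_le_eq[symmetric] by (intro computable_intros)

lemma decidable_eq [computable_intros]: "computable A f \<Longrightarrow> computable A g \<Longrightarrow> decidable A (\<lambda>x. f x = g x)"
  unfolding eq_iff by (intro computable_intros)

section \<open>Bounded quantifiers, sums, iteration and binary digits\<close>

lemma rec_ex: "rec_nat 0 (\<lambda>i r. if P i then 1 else r) n = (of_bool (\<exists>i<n. P i) :: nat)"
  by (induction n) (auto simp: less_Suc_eq)

lemma decidable_ex_less [computable_intros]: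
  assumes "decidable A (\<lambda>z. P (pfst z) (psnd z))" "computable A n"
  shows "decidable A (\<lambda>x. \<exists>i<n x. P x i)"
proof -
  have "decidable A (\<lambda>z. P (pfst z) (pfst (psnd z)))"
    using decidable_compose[OF assms(1), of "\<lambda>z. prod_encode (pfst z, pfst (psnd z))"]
    by (simp add: computable_intros)
  then show ?thesis
    unfolding decidable_def rec_ex[symmetric] by (intro computable_intros assms) (simp add: decidable_def)
qed

lemma decidable_all_less [computable_intros]:
  assumes "decidable A (\<lambda>z. P (pfst z) (psnd z))" "computable A n"
  shows "decidable A (\<lambda>x. \<forall>i<n x. P x i)"
proof -
  have "decidable A (\<lambda>x. \<not> (\<exists>i<n x. \<not> P x i))" by (intro computable_intros assms)
  then show ?thesis by simp
qed

lemma rec_sum: "rec_nat 0 (\<lambda>i r. r + F i) n = (\<Sum>i<n. F i)" for F :: "nat \<Rightarrow> nat"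
  by (induction n) simp_all

lemma computable_sum [computable_intros]:
  assumes "computable A (\<lambda>z. F (pfst z) (psnd z))" "computable A n"
  shows "computable A (\<lambda>x. \<Sum>i<n x. F x i)"
proof -
  have "computable A (\<lambda>z. F (pfst z) (pfst (psnd z)))"
    using computable_compose[OF assms(1), of "\<lambda>z. prod_encode (pfst z, pfst (psnd z))"]
    by (simp add: computable_intros)
  then show ?thesis
    unfolding rec_sum[symmetric] by (intro computable_intros assms)
qed

lemma rec_funpow: "rec_nat x (\<lambda>_. f) n = (f ^^ n) x"
  by (induction n) simp_all

lemma computable_funpow [computable_intros]:
  assumes "computable A f" "computable A n" "computable A g"
  shows "computable A (\<lambda>x. (f ^^ n x) (g x))"
  unfolding rec_funpow[symmetric]
  by (intro computable_intros assms computable_compose[OF assms(1)])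

lemma rec_half: "rec_nat 0 (\<lambda>i r. r + rec_nat 0 (\<lambda>_ r. 1 - r) i) n = n div 2" for n :: nat
  by (induction n) (simp_all only: rec_parity, simp_all, presburger)

lemma funpow_half: "((\<lambda>x. x div 2) ^^ m) n = n div 2 ^ m" for n :: nat
  by (induction m) (simp_all add: div_mult2_eq[symmetric] mult.commute)

lemma computable_shift [computable_intros]:
  assumes "computable A f" "computable A g"
  shows "computable A (\<lambda>x. f x div 2 ^ g x)"
proof -
  have "computable A (\<lambda>x. x div 2)"
    unfolding rec_half[symmetric] by (intro computable_intros)
  then show ?thesis
    unfolding funpow_half[symmetric] by (intro computable_intros assms)
qed

lemma computable_mod_power [computable_intros]:
  assumes "computable A f" "computable A g"
  shows "computable A (\<lambda>x. f x mod 2 ^ g x)"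
  unfolding minus_div_mult_eq_mod[symmetric] by (intro computable_intros assms)

lemma decidable_set_decode [computable_intros]:
  assumes "computable A f" "computable A g"
  shows "decidable A (\<lambda>x. g x \<in> set_decode (f x))"
proof -
  have "n \<in> set_decode m \<longleftrightarrow> m div 2 ^ n mod 2 ^ 1 = 1" for m n
    by (simp add: set_decode_def odd_iff_mod_2_eq_one)
  then show ?thesis
    by (simp only:) (intro computable_intros assms)
qed

lemma decidable_oracle [computable_intros]: "computable A f \<Longrightarrow> decidable A (\<lambda>x. A (f x))"
  by (rule decidable_compose[of A A]) (unfold decidable_def computable_def, meson run.query)

text \<open>\<open>PMin\<close> searches for a zero and demands positive values before it, hence the
  truth value of the negation.\<close>

lemma computable_Least:
  assumes "decidable A (\<lambda>z. P (pfst z) (psnd z))" "\<And>x. \<exists>i. P x i"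
  shows "computable A (\<lambda>x. LEAST i. P x i)"
proof -
  have "computable A (\<lambda>z. of_bool (\<not> P (pfst z) (psnd z)))"
    using assms(1) by (intro computable_intros)
  then obtain p where p: "\<And>z. run A p z (of_bool (\<not> P (pfst z) (psnd z)))"
    by (auto simp: computable_def)
  have "run A (PMin p) x (LEAST i. P x i)" for x
  proof (rule run.min)
    show "run A p (prod_encode (x, LEAST i. P x i)) 0"
      using p[of "prod_encode (x, LEAST i. P x i)"] LeastI_ex[OF assms(2)[of x]] by simp
  next
    fix i assume "i < (LEAST i. P x i)"
    then have "\<not> P x i" by (rule not_less_Least)
    then show "\<exists>y>0. run A p (prod_encode (x, i)) y"
      using p[of "prod_encode (x, i)"] by (auto intro!: exI[of _ 1])
  qed
  then show ?thesis unfolding computable_def by blast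
qed

section \<open>Simulation of programs\<close>

primrec prog_code :: "prog \<Rightarrow> nat" where
  "prog_code PZero = prod_encode (0, 0)"
| "prog_code PSucc = prod_encode (1, 0)"
| "prog_code PFst = prod_encode (2, 0)"
| "prog_code PSnd = prod_encode (3, 0)"
| "prog_code POracle = prod_encode (4, 0)"
| "prog_code (PPair p q) = prod_encode (5, prod_encode (prog_code p, prog_code q))"
| "prog_code (PComp p q) = prod_encode (6, prod_encode (prog_code p, prog_code q))"
| "prog_code (PRec p q) = prod_encode (7, prod_encode (prog_code p, prog_code q))"
| "prog_code (PMin p) = prod_encode (8, prog_code p)"

definition holds :: "nat \<Rightarrow> nat \<Rightarrow> nat \<Rightarrow> nat \<Rightarrow> bool" where
  "holds F c x y \<longleftrightarrow> prod_encode (c, prod_encode (x, y)) \<in> set_decode F"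

text \<open>The rules of \<open>run\<close> as one inference whose premises are looked up in the
  finite table \<open>F\<close>. The bound \<open>s\<close> on intermediate values keeps every
  quantifier bounded and the inference decidable.\<close>

definition follows :: "nat \<Rightarrow> nat \<Rightarrow> nat \<Rightarrow> nat \<Rightarrow> nat \<Rightarrow> bool" where
  "follows s F c x y \<longleftrightarrow>
     pfst c = 0 \<and> y = 0 \<or>
     pfst c = 1 \<and> y = Suc x \<or>
     pfst c = 2 \<and> y = pfst x \<or>
     pfst c = 3 \<and> y = psnd x \<or>
     pfst c = 4 \<and> y = 0 \<or>
     pfst c = 5 \<and> holds F (pfst (psnd c)) x (pfst y) \<and> holds F (psnd (psnd c)) x (psnd y) \<or>
     pfst c = 6 \<and> (\<exists>u<s. holds F (psnd (psnd c)) x u \<and> holds F (pfst (psnd c)) u y) \<or>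
     pfst c = 7 \<and> (psnd x = 0 \<and> holds F (pfst (psnd c)) (pfst x) y \<or>
       0 < psnd x \<and> (\<exists>u<s. holds F c (prod_encode (pfst x, psnd x - 1)) u \<and>
         holds F (psnd (psnd c)) (prod_encode (pfst x, prod_encode (psnd x - 1, u))) y)) \<or>
     pfst c = 8 \<and> holds F (psnd c) (prod_encode (x, y)) 0 \<and>
       (\<forall>i<y. \<exists>u<s. 0 < u \<and> holds F (psnd c) (prod_encode (x, i)) u)"

text \<open>
  Bit \<open>t\<close> of \<open>sim s\<close> says that the triple (program, input, output) coded by \<open>t\<close> has a derivation of height
  at most \<open>s\<close> in which all numbers are below \<open>s\<close>; rule \<open>query\<close> is used for the empty oracle.
\<close>

definition sim :: "nat \<Rightarrow> nat" where
  "sim n = rec_nat 0 (\<lambda>s F. \<Sum>t<s. of_bool (follows s F (pfst t) (pfst (psnd t)) (psnd (psnd t))) * 2 ^ t) n"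

lemma set_decode_sum: "set_decode (\<Sum>t<s. of_bool (P t) * 2 ^ t) = {t. t < s \<and> P t}"
proof -
  have "(\<Sum>t<s. of_bool (P t) * 2 ^ t) = (\<Sum>t\<in>{t. t < s \<and> P t}. 2 ^ t :: nat)"
    by (rule sum.mono_neutral_cong_right) auto
  then show ?thesis by (simp add: set_encode_def[symmetric])
qed

lemma holds_sim_0 [simp]: "\<not> holds (sim 0) c x y"
  by (simp add: sim_def holds_def)

lemma holds_sim_Suc: "holds (sim (Suc s)) c x y \<longleftrightarrow>
    prod_encode (c, prod_encode (x, y)) < s \<and> follows s (sim s) c x y"
proof -
  have "sim (Suc s) =
      (\<Sum>t<s. of_bool (follows s (sim s) (pfst t) (pfst (psnd t)) (psnd (psnd t))) * 2 ^ t)"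
    by (simp add: sim_def)
  then show ?thesis
    unfolding holds_def by (simp only: set_decode_sum) simp
qed

text \<open>The table occurs only positively in the rules, and a larger \<open>s\<close> only admits
  more witnesses.\<close>

lemma follows_mono:
  assumes "follows s F c x y" "s \<le> s'" "\<And>c x y. holds F c x y \<Longrightarrow> holds F' c x y"
  shows "follows s' F' c x y"
  using assms(1) unfolding follows_def
  by (elim disj_forward conj_forward all_forward imp_forward ex_forward assms(3))
    (use assms(2) in auto)

lemma holds_sim_step: "holds (sim s) c x y \<Longrightarrow> holds (sim (Suc s)) c x y"
proof (induction s arbitrary: c x y)
  case (Suc s)
  then show ?case
    unfolding holds_sim_Suc[of "Suc s"] using holds_sim_Suc[of s]
    by (meson follows_mono lessI less_imp_le less_trans)
qed simp

lemma holds_sim_mono: "holds (sim s) c x y \<Longrightarrow> s \<le> s' \<Longrightarrow> holds (sim s') c x y"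
  by (rule lift_Suc_mono_le[where f = "\<lambda>s. holds (sim s) c x y", simplified le_bool_def, rule_format])
    (use holds_sim_step in auto)

lemma sim_sound: "holds (sim s) (prog_code p) x y \<Longrightarrow> run (\<lambda>_. False) p x y"
proof (induction s arbitrary: p x y)
  case (Suc s)
  then have f: "follows s (sim s) (prog_code p) x y"
    by (simp add: holds_sim_Suc)
  show ?case
  proof (cases p)
    case PZero
    then show ?thesis using f by (auto simp: follows_def intro: run.zero)
  next
    case PSucc
    then show ?thesis using f by (auto simp: follows_def intro: run.succ)
  next
    case PFst
    then show ?thesis using f by (auto simp: follows_def intro: run_pfst)
  next
    case PSnd
    then show ?thesis using f by (auto simp: follows_def intro: run_psnd)
  next
    case POracle
    then show ?thesis using f run.query[of "\<lambda>_. False" x] by (auto simp: follows_def)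
  next
    case (PPair q r)
    then have "run (\<lambda>_. False) q x (pfst y)" "run (\<lambda>_. False) r x (psnd y)"
      using f Suc.IH by (auto simp: follows_def)
    from run.pair[OF this] show ?thesis using PPair by simp
  next
    case (PComp q r)
    then show ?thesis using f Suc.IH by (auto simp: follows_def intro: run.comp)
  next
    case (PRec q r)
    obtain a n where x: "x = prod_encode (a, n)" by (metis encode_pfst_psnd)
    show ?thesis
    proof (cases n)
      case 0
      then show ?thesis using f PRec Suc.IH x by (auto simp: follows_def intro: run.rec_0)
    next
      case (Suc k)
      then obtain u where "holds (sim s) (prog_code p) (prod_encode (a, k)) u"
        "holds (sim s) (prog_code r) (prod_encode (a, prod_encode (k, u))) y"
        using f PRec x by (auto simp: follows_def)
      then have "run (\<lambda>_. False) p (prod_encode (a, k)) u"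
        "run (\<lambda>_. False) r (prod_encode (a, prod_encode (k, u))) y"
        by (auto dest: Suc.IH)
      then show ?thesis unfolding PRec x Suc by (rule run.rec_Suc)
    qed
  next
    case (PMin q)
    then have h: "holds (sim s) (prog_code q) (prod_encode (x, y)) 0"
      and less: "\<forall>i<y. \<exists>u<s. 0 < u \<and> holds (sim s) (prog_code q) (prod_encode (x, i)) u"
      using f by (simp_all add: follows_def)
    show ?thesis unfolding PMin
    proof (rule run.min)
      show "run (\<lambda>_. False) q (prod_encode (x, y)) 0" using h by (rule Suc.IH)
      show "\<exists>u>0. run (\<lambda>_. False) q (prod_encode (x, i)) u" if "i < y" for i
        using less that Suc.IH by blast
    qed
  qed
qed simp

lemma sim_followsI: "follows s (sim s) c x y \<Longrightarrow> \<exists>s. holds (sim s) c x y"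
proof -
  assume f: "follows s (sim s) c x y"
  \<comment> \<open>The table of stage \<open>Suc s'\<close> lists only codes below
    \<open>s'\<close>, so \<open>s'\<close> must exceed the code of the conclusion.\<close>
  define s' where "s' = s + Suc (prod_encode (c, prod_encode (x, y)))"
  have "follows s' (sim s') c x y"
    by (rule follows_mono[OF f]) (auto simp: s'_def intro: holds_sim_mono)
  then have "holds (sim (Suc s')) c x y"
    by (simp add: holds_sim_Suc) (simp add: s'_def)
  then show ?thesis by blast
qed

text \<open>Every rule instance has finitely many premises, so the stages found for them have a
  common bound.\<close>

lemma sim_complete:
  assumes "run (\<lambda>_. False) p x y"
  shows "\<exists>s. holds (sim s) (prog_code p) x y"
  using assms
proof (induction rule: run.induct)
  case (pair p x y q z)
  then obtain s s' where "holds (sim s) (prog_code p) x y" "holds (sim s') (prog_code q) x z"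
    by auto
  then have "holds (sim (max s s')) (prog_code p) x y" "holds (sim (max s s')) (prog_code q) x z"
    by (auto intro: holds_sim_mono)
  then show ?case by (intro sim_followsI[of "max s s'"]) (simp add: follows_def)
next
  case (comp q x y p z)
  then obtain s s' where s: "holds (sim s) (prog_code q) x y" "holds (sim s') (prog_code p) y z"
    by auto
  define t where "t = s + s' + Suc y"
  have "holds (sim t) (prog_code q) x y" "holds (sim t) (prog_code p) y z" "y < t"
    using s by (auto simp: t_def intro: holds_sim_mono)
  then show ?case by (intro sim_followsI[of t]) (auto simp add: follows_def)
next
  case (rec_0 p x y q)
  then obtain s where "holds (sim s) (prog_code p) x y" by auto
  then show ?case by (intro sim_followsI[of s]) (simp add: follows_def)
next
  case (rec_Suc p q x n y z)
  then obtain s s' where s: "holds (sim s) (prog_code (PRec p q)) (prod_encode (x, n)) y"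
    "holds (sim s') (prog_code q) (prod_encode (x, prod_encode (n, y))) z"
    by auto
  define t where "t = s + s' + Suc y"
  have "holds (sim t) (prog_code (PRec p q)) (prod_encode (x, n)) y"
    "holds (sim t) (prog_code q) (prod_encode (x, prod_encode (n, y))) z" "y < t"
    using s by (auto simp: t_def intro: holds_sim_mono)
  then show ?case by (intro sim_followsI[of t]) (auto simp add: follows_def)
next
  case (min p x n)
  then obtain s0 where s0: "holds (sim s0) (prog_code p) (prod_encode (x, n)) 0" by auto
  have "\<forall>i<n. \<exists>u s. 0 < u \<and> holds (sim s) (prog_code p) (prod_encode (x, i)) u"
    using min by blast
  then obtain u s where us: "\<And>i. i < n \<Longrightarrow> 0 < u i \<and>
      holds (sim (s i)) (prog_code p) (prod_encode (x, i)) (u i)"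
    by metis
  define t where "t = s0 + (\<Sum>i<n. s i) + Suc (\<Sum>i<n. u i)"
  have t: "s i \<le> t" "u i < t" if "i < n" for i
    using that member_le_sum[of i "{..<n}" s] member_le_sum[of i "{..<n}" u]
    by (auto simp: t_def)
  have "holds (sim t) (prog_code p) (prod_encode (x, n)) 0"
    using s0 by (auto simp: t_def intro: holds_sim_mono)
  then show ?case using us t
    by (intro sim_followsI[of t]) (simp add: follows_def, meson holds_sim_mono)
qed (rule sim_followsI, simp add: follows_def)+

lemma decidable_holds [computable_intros]:
  assumes "computable A f" "computable A g" "computable A h" "computable A k"
  shows "decidable A (\<lambda>x. holds (f x) (g x) (h x) (k x))"
  unfolding holds_def by (intro computable_intros assms)

lemma computable_sim [computable_intros]:
  assumes "computable A f"
  shows "computable A (\<lambda>x. sim (f x))"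
proof -
  have "computable A sim"
    unfolding sim_def follows_def by (intro computable_intros)
  from computable_compose[OF this assms] show ?thesis .
qed

section \<open>Finite prefixes as numbers, and open sets enumerated in stages\<close>

fun prefix_num :: "cantor \<Rightarrow> nat \<Rightarrow> nat" where
  "prefix_num X 0 = 0"
| "prefix_num X (Suc n) = prefix_num X n + of_bool (X n) * 2 ^ n"

lemma prefix_num_eq_sum: "prefix_num X n = (\<Sum>i<n. of_bool (X i) * 2 ^ i)"
  by (induction n) simp_all

lemma set_decode_prefix_num: "set_decode (prefix_num X n) = {i. i < n \<and> X i}"
  unfolding prefix_num_eq_sum by (rule set_decode_sum)

lemma prefix_num_less: "prefix_num X n < 2 ^ n"
  by (induction n) auto

text \<open>Bit \<open>i\<close> has weight \<open>2 ^ i\<close>, so truncating a prefix is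
  reduction modulo a power of two. The length is not part of the code and has to be carried
  along.\<close>

lemma prefix_num_mod: "m \<le> n \<Longrightarrow> prefix_num X n mod 2 ^ m = prefix_num X m"
proof (induction n)
  case (Suc n)
  show ?case
  proof (cases "m = Suc n")
    case True
    then show ?thesis using mod_less[OF prefix_num_less[of X "Suc n"]] by (simp only:)
  next
    case False
    then have "m \<le> n" using Suc.prems by simp
    then have "(of_bool (X n) * 2 ^ n) mod 2 ^ m = (0 :: nat)"
      by (simp add: le_imp_power_dvd)
    then show ?thesis
      using Suc.IH[OF \<open>m \<le> n\<close>] by (metis add.right_neutral mod_add_right_eq prefix_num.simps(2))
  qed
qed simp

lemma prefix_num_eq_iff: "prefix_num X n = prefix_num Y n \<longleftrightarrow> (\<forall>i<n. X i = Y i)"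
proof
  assume "prefix_num X n = prefix_num Y n"
  then have "{i. i < n \<and> X i} = {i. i < n \<and> Y i}" by (metis set_decode_prefix_num)
  then show "\<forall>i<n. X i = Y i" by blast
qed (simp add: prefix_num_eq_sum)

lemma prefix_num_surj: assumes "v < 2 ^ n" obtains X where "prefix_num X n = v"
proof
  let ?X = "\<lambda>i. i \<in> set_decode v"
  have "i < n" if "i \<in> set_decode v" for i
  proof (rule ccontr)
    assume "\<not> i < n"
    then have "v < 2 ^ i" using assms
      by (meson less_le_trans not_less one_le_numeral power_increasing)
    then show False using that by (simp add: set_decode_def)
  qed
  then have "set_decode (prefix_num ?X n) = set_decode v" by (auto simp: set_decode_prefix_num)
  then show "prefix_num ?X n = v" by (metis set_decode_inverse)
qed

text \<open>Bridges numeric prefixes and string codes. \<open>list_encode\<close> adds elements in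
  front, so the bits are read from the last to the first.\<close>

definition prefix_code :: "nat \<Rightarrow> nat \<Rightarrow> nat" where
  "prefix_code v l =
     rec_nat 0 (\<lambda>j r. Suc (prod_encode (of_bool (l - Suc j \<in> set_decode v), r))) l"

lemma prefix_code:
  assumes "l \<le> s"
  shows "prefix_code (prefix_num X s) l = string_code (map X [0..<l])"
proof -
  define H where
    "H = (\<lambda>j r. Suc (prod_encode (of_bool (l - Suc j \<in> set_decode (prefix_num X s)), r)))"
  have "rec_nat 0 H j = list_encode (map of_bool (map X [l - j..<l]))" if "j \<le> l" for j
    using that
  proof (induction j)
    case (Suc j)
    then have "[l - Suc j..<l] = (l - Suc j) # [l - j..<l]"
      using upt_conv_Cons[of "l - Suc j" l] by (simp add: Suc_diff_Suc)
    moreover have "l - Suc j \<in> set_decode (prefix_num X s) \<longleftrightarrow> X (l - Suc j)"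
      using Suc.prems assms by (auto simp: set_decode_prefix_num)
    ultimately show ?case
      using Suc by (simp add: H_def)
  qed simp
  from this[of l] show ?thesis
    by (simp add: prefix_code_def H_def string_code_def)
qed

lemma cylinder_iff: "X \<in> cylinder \<sigma> \<longleftrightarrow> \<sigma> = map X [0..<length \<sigma>]"
  unfolding cylinder_def by (subst list_eq_iff_nth_eq) auto

text \<open>
  The set number \<open>(i, k)\<close> is the intersection of the first \<open>k + 1\<close> open sets of the uniform sequence
  given by program number \<open>i\<close>. Taking intersections makes it decreasing in \<open>k\<close>. Here \<open>v\<close> codes a
  prefix of length \<open>s\<close>.
\<close>

definition in_V :: "nat \<Rightarrow> nat \<Rightarrow> nat \<Rightarrow> nat \<Rightarrow> bool" where
  "in_V i k s v \<longleftrightarrow> (\<forall>j<Suc k. \<exists>l<Suc s. \<exists>y<s.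
     holds (sim s) i (prod_encode (j, prefix_code v l)) y)"

lemma in_V_mono:
  assumes "in_V i k s (prefix_num X s)" "s \<le> s'"
  shows "in_V i k s' (prefix_num X s')"
  unfolding in_V_def
proof (intro allI impI)
  fix j assume "j < Suc k"
  then obtain l y where ly: "l < Suc s" "y < s"
      "holds (sim s) i (prod_encode (j, prefix_code (prefix_num X s) l)) y"
    using assms(1) by (auto simp: in_V_def)
  then have "holds (sim s') i (prod_encode (j, prefix_code (prefix_num X s') l)) y"
    using assms(2) holds_sim_mono[OF _ assms(2)] by (simp add: prefix_code)
  with ly assms(2) show "\<exists>l<Suc s'. \<exists>y<s'. holds (sim s') i (prod_encode (j, prefix_code (prefix_num X s') l)) y"
    by (meson less_le_trans Suc_le_mono)
qed

definition Vset :: "nat \<Rightarrow> nat \<Rightarrow> cantor set" where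
  "Vset i k = {X. \<exists>s. in_V i k s (prefix_num X s)}"

text \<open>The bounds on lengths, outputs and stages disappear in the union over \<open>s\<close>:
  soundness of the simulation gives one inclusion, and for the other the finitely many
  \<open>j \<le> k\<close> share one bound.\<close>

lemma Vset_prog_code:
  assumes p: "\<And>k \<sigma>. \<sigma> \<in> S k \<longleftrightarrow> (\<exists>y. run (\<lambda>_. False) p (prod_encode (k, string_code \<sigma>)) y)"
  shows "Vset (prog_code p) k = (\<Inter>j\<le>k. \<Union>\<sigma>\<in>S j. cylinder \<sigma>)"
proof (intro set_eqI iffI)
  fix X assume "X \<in> Vset (prog_code p) k"
  then obtain s where s: "in_V (prog_code p) k s (prefix_num X s)" by (auto simp: Vset_def)
  show "X \<in> (\<Inter>j\<le>k. \<Union>\<sigma>\<in>S j. cylinder \<sigma>)"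
  proof
    fix j assume "j \<in> {..k}"
    then obtain l y where "l \<le> s"
        "holds (sim s) (prog_code p) (prod_encode (j, prefix_code (prefix_num X s) l)) y"
      using s by (auto simp: in_V_def less_Suc_eq_le)
    then have "map X [0..<l] \<in> S j"
      by (auto simp: prefix_code p intro: sim_sound)
    then show "X \<in> (\<Union>\<sigma>\<in>S j. cylinder \<sigma>)"
      by (intro UN_I[of "map X [0..<l]"]) (auto simp: cylinder_iff)
  qed
next
  fix X assume X: "X \<in> (\<Inter>j\<le>k. \<Union>\<sigma>\<in>S j. cylinder \<sigma>)"
  have "\<exists>l y s. holds (sim s) (prog_code p) (prod_encode (j, string_code (map X [0..<l]))) y"
    if "j \<le> k" for j
  proof -
    have "X \<in> (\<Union>\<sigma>\<in>S j. cylinder \<sigma>)" using INT_D[OF X, of j] that by simp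
    then obtain \<sigma> where "\<sigma> \<in> S j" "X \<in> cylinder \<sigma>" by (elim UN_E)
    then have "map X [0..<length \<sigma>] \<in> S j" unfolding cylinder_iff by (elim subst)
    then show ?thesis using p sim_complete by blast
  qed
  then obtain l y s where lys: "\<And>j. j \<le> k \<Longrightarrow>
      holds (sim (s j)) (prog_code p) (prod_encode (j, string_code (map X [0..<l j]))) (y j)"
    by metis
  define t where "t = Suc (\<Sum>j\<le>k. l j + y j + s j)"
  have t: "l j + y j + s j < t" if "j \<le> k" for j
    using that member_le_sum[of j "{..k}" "\<lambda>j. l j + y j + s j"] by (simp add: t_def)
  have "in_V (prog_code p) k t (prefix_num X t)"
    unfolding in_V_def
  proof (intro allI impI)
    fix j assume "j < Suc k"
    then have j: "j \<le> k" by simp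
    have "holds (sim t) (prog_code p) (prod_encode (j, prefix_code (prefix_num X t) (l j))) (y j)"
      using holds_sim_mono[OF lys[OF j], of t] t[OF j] by (simp add: prefix_code)
    then show "\<exists>l<Suc t. \<exists>y<t. holds (sim t) (prog_code p) (prod_encode (j, prefix_code (prefix_num X t) l)) y"
      using t[OF j] by (intro exI[of _ "l j"] exI[of _ "y j"] conjI) auto
  qed
  then show "X \<in> Vset (prog_code p) k" unfolding Vset_def by blast
qed

text \<open>The only place where the decoder consults its oracle.\<close>

lemma computable_prefix_num: "computable A f \<Longrightarrow> computable A (\<lambda>x. prefix_num A (f x))"
  unfolding prefix_num_eq_sum by (intro computable_intros)

lemma computable_prefix_code [computable_intros]:
  assumes "computable A f" "computable A g"
  shows "computable A (\<lambda>x. prefix_code (f x) (g x))"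
proof -
  have "computable A (\<lambda>z. prefix_code (pfst z) (psnd z))"
    unfolding prefix_code_def by (intro computable_intros)
  from computable_compose[OF this computable_pair[OF assms]] show ?thesis by simp
qed

lemma decidable_in_V [computable_intros]:
  assumes "computable A f" "computable A g" "computable A h" "computable A k"
  shows "decidable A (\<lambda>x. in_V (f x) (g x) (h x) (k x))"
proof -
  have "decidable A (\<lambda>z. in_V (pfst z) (pfst (psnd z)) (pfst (psnd (psnd z))) (psnd (psnd (psnd z))))"
    unfolding in_V_def by (intro computable_intros)
  from decidable_compose[OF this computable_pair[OF assms(1) computable_pair[OF assms(2) computable_pair[OF assms(3,4)]]]]
  show ?thesis by simp
qed

section \<open>The decoder\<close>

text \<open>
  A stack is a nested pair, with \<open>0\<close> as the empty stack. The decoder keeps a stack of requirements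
  \<open>req i k m d\<close>: the input stays out of the open set number \<open>(i, k)\<close>, and when the requirement was
  pushed, at prefix length \<open>m\<close>, a relative measure of at least \<open>2 ^ - d\<close> was reserved for that.
\<close>

definition stack_tl :: "nat \<Rightarrow> nat" where "stack_tl z = psnd (z - 1)"
definition stack_hd :: "nat \<Rightarrow> nat" where "stack_hd z = pfst (z - 1)"
definition push :: "nat \<Rightarrow> nat \<Rightarrow> nat" where "push e c = Suc (prod_encode (e, c))"

lemma stack_tl_cons [simp]: "stack_tl (push e c) = c"
  and stack_hd_cons [simp]: "stack_hd (push e c) = e"
  and stack_tl_0 [simp]: "stack_tl 0 = 0"
  and push_neq_0 [simp]: "push e c \<noteq> 0"
  by (simp_all add: stack_tl_def stack_hd_def push_def)

lemma push_hd_tl: "z \<noteq> 0 \<Longrightarrow> push (stack_hd z) (stack_tl z) = z"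
  by (simp add: stack_tl_def stack_hd_def push_def)

lemma less_push: "c < push e c"
  by (simp add: push_def le_prod_encode_2 less_Suc_eq_le)

lemma stack_tl_less: "z \<noteq> 0 \<Longrightarrow> stack_tl z < z"
  by (metis push_hd_tl less_push)

text \<open>Suffixes rather than entries, because a requirement is judged together with those below
  it. The height of a stack is at most its code, which bounds the search.\<close>

definition any_suffix :: "(nat \<Rightarrow> bool) \<Rightarrow> nat \<Rightarrow> bool" where
  "any_suffix P z \<longleftrightarrow> (\<exists>a<z. (stack_tl ^^ a) z \<noteq> 0 \<and> P ((stack_tl ^^ a) z))"

lemma funpow_stack_tl_0 [simp]: "(stack_tl ^^ a) 0 = 0"
  by (induction a) simp_all

lemma funpow_stack_tl_le: "(stack_tl ^^ a) z \<le> z - a"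
proof (induction a)
  case (Suc a)
  show ?case
  proof (cases "(stack_tl ^^ a) z = 0")
    case False
    then show ?thesis using stack_tl_less[OF False] Suc by simp
  qed simp
qed simp

lemma any_suffix_iff: "any_suffix P z \<longleftrightarrow> (\<exists>a. (stack_tl ^^ a) z \<noteq> 0 \<and> P ((stack_tl ^^ a) z))"
proof -
  have "a < z" if "(stack_tl ^^ a) z \<noteq> 0" for a
    using that funpow_stack_tl_le[of a z] by (cases "a < z") auto
  then show ?thesis unfolding any_suffix_def by blast
qed

lemma any_suffix_0 [simp]: "\<not> any_suffix P 0"
  by (simp add: any_suffix_def)

lemma any_suffix_cons [simp]: "any_suffix P (push e c) \<longleftrightarrow> P (push e c) \<or> any_suffix P c"
proof
  assume "any_suffix P (push e c)"
  then obtain a where a: "(stack_tl ^^ a) (push e c) \<noteq> 0" "P ((stack_tl ^^ a) (push e c))"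
    by (auto simp: any_suffix_iff)
  show "P (push e c) \<or> any_suffix P c"
  proof (cases a)
    case (Suc b)
    then have "(stack_tl ^^ a) (push e c) = (stack_tl ^^ b) c" by (simp only: funpow_Suc_right) simp
    then show ?thesis using a by (auto simp: any_suffix_iff)
  qed (use a in simp)
next
  assume "P (push e c) \<or> any_suffix P c"
  then show "any_suffix P (push e c)"
  proof
    assume "P (push e c)"
    then show ?thesis unfolding any_suffix_iff by (intro exI[of _ 0]) simp
  next
    assume "any_suffix P c"
    then obtain a where "(stack_tl ^^ a) c \<noteq> 0" "P ((stack_tl ^^ a) c)" by (auto simp: any_suffix_iff)
    then have "(stack_tl ^^ Suc a) (push e c) \<noteq> 0 \<and> P ((stack_tl ^^ Suc a) (push e c))"
      by (simp only: funpow_Suc_right) simp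
    then show ?thesis unfolding any_suffix_iff by blast
  qed
qed

lemma stack_induct [case_names empty cons]:
  assumes "P 0" "\<And>e c. P c \<Longrightarrow> P (push e c)" shows "P z"
proof (induction z rule: less_induct)
  case (less z)
  then show ?case using assms stack_tl_less[of z] push_hd_tl[of z] by metis
qed

lemma any_suffix_tl: "any_suffix P (stack_tl z) \<Longrightarrow> any_suffix P z"
  by (cases "z = 0") (simp, metis any_suffix_cons push_hd_tl)

section \<open>Requirements and density tests at a stage\<close>

definition req :: "nat \<Rightarrow> nat \<Rightarrow> nat \<Rightarrow> nat \<Rightarrow> nat" where
  "req i k m d = prod_encode (i, prod_encode (k, prod_encode (m, d)))"
definition reqI :: "nat \<Rightarrow> nat" where "reqI e = pfst e"
definition reqK :: "nat \<Rightarrow> nat" where "reqK e = pfst (psnd e)"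
definition reqM :: "nat \<Rightarrow> nat" where "reqM e = pfst (psnd (psnd e))"
definition reqD :: "nat \<Rightarrow> nat" where "reqD e = psnd (psnd (psnd e))"

lemma req_simps [simp]:
  "reqI (req i k m d) = i" "reqK (req i k m d) = k" "reqM (req i k m d) = m" "reqD (req i k m d) = d"
  by (simp_all add: req_def reqI_def reqK_def reqM_def reqD_def)

definition in_W :: "nat \<Rightarrow> nat \<Rightarrow> nat \<Rightarrow> bool" where
  "in_W c s v \<longleftrightarrow> any_suffix (\<lambda>w. in_V (reqI (stack_hd w)) (reqK (stack_hd w)) s v) c"

text \<open>
  At stage \<open>s \<ge> m\<close>: the cylinder of the prefix \<open>v\<close> of length \<open>m\<close> minus the part of the open set
  enumerated so far has measure at least \<open>2 ^ - (m + d)\<close>. The inequality is multiplied by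
  \<open>2 ^ (s + m + d)\<close> to stay within the natural numbers.
\<close>

definition dense_off_at :: "nat \<Rightarrow> nat \<Rightarrow> nat \<Rightarrow> nat \<Rightarrow> nat \<Rightarrow> bool" where
  "dense_off_at c m v d s \<longleftrightarrow>
     (2 :: nat) ^ s \<le> (\<Sum>t<2 ^ s. of_bool (t mod 2 ^ m = v \<and> \<not> in_W c s t)) * 2 ^ (m + d)"

text \<open>Tested at the prefix where the requirement was pushed, not at the current one, so
  symbols sent later cannot change the verdict.\<close>

definition violated :: "nat \<Rightarrow> nat \<Rightarrow> nat \<Rightarrow> bool" where
  "violated s x w \<longleftrightarrow> \<not> dense_off_at w (reqM (stack_hd w)) (x mod 2 ^ reqM (stack_hd w)) (reqD (stack_hd w)) s"

text \<open>Left and right refer to the numeric order of prefix codes. The piece containing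
  \<open>x\<close> is not tested itself; only its competitors must look bad.\<close>

definition leftmost :: "nat \<Rightarrow> nat \<Rightarrow> nat \<Rightarrow> nat \<Rightarrow> nat \<Rightarrow> bool" where
  "leftmost s x z m d \<longleftrightarrow> (\<forall>v<x mod 2 ^ Suc (m + d). v mod 2 ^ m = x mod 2 ^ m \<longrightarrow>
     \<not> dense_off_at z (Suc (m + d)) v (Suc d) s)"

definition rightmost :: "nat \<Rightarrow> nat \<Rightarrow> nat \<Rightarrow> nat \<Rightarrow> nat \<Rightarrow> bool" where
  "rightmost s x z m d \<longleftrightarrow> (\<forall>v<2 ^ Suc (m + d). x mod 2 ^ Suc (m + d) < v \<longrightarrow>
     v mod 2 ^ m = x mod 2 ^ m \<longrightarrow> \<not> dense_off_at z (Suc (m + d)) v (Suc d) s)"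

text \<open>
  A state consists of the requirement stack \<open>z\<close>, the length \<open>m\<close> of the prefix at the last event, the
  exponent \<open>d\<close> of the relative density guaranteed there, the number \<open>j\<close> of symbols \<open>0\<close> received since
  the last command, and the output so far: \<open>l\<close> bits, which are the binary digits of \<open>v\<close>.
\<close>

definition mk_state :: "nat \<Rightarrow> nat \<Rightarrow> nat \<Rightarrow> nat \<Rightarrow> nat \<Rightarrow> nat \<Rightarrow> nat" where
  "mk_state z m d j l v =
     prod_encode (z, prod_encode (m, prod_encode (d, prod_encode (j, prod_encode (l, v)))))"
definition st_stack :: "nat \<Rightarrow> nat" where "st_stack st = pfst st"
definition st_base :: "nat \<Rightarrow> nat" where "st_base st = pfst (psnd st)"
definition st_loss :: "nat \<Rightarrow> nat" where "st_loss st = pfst (psnd (psnd st))"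
definition st_count :: "nat \<Rightarrow> nat" where "st_count st = pfst (psnd (psnd (psnd st)))"
definition st_len :: "nat \<Rightarrow> nat" where "st_len st = pfst (psnd (psnd (psnd (psnd st))))"
definition st_out :: "nat \<Rightarrow> nat" where "st_out st = psnd (psnd (psnd (psnd (psnd st))))"

lemma mk_state_simps [simp]:
  "st_stack (mk_state z m d j l v) = z" "st_base (mk_state z m d j l v) = m" "st_loss (mk_state z m d j l v) = d"
  "st_count (mk_state z m d j l v) = j" "st_len (mk_state z m d j l v) = l" "st_out (mk_state z m d j l v) = v"
  by (simp_all add: mk_state_def st_stack_def st_base_def st_loss_def st_count_def st_len_def st_out_def)

text \<open>
  A command is a block of \<open>j\<close> symbols \<open>0\<close> followed by a symbol \<open>1\<close>. It appends the bit \<open>j\<close> if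
  \<open>j < 2\<close> and pushes a requirement for program \<open>j - 2\<close> otherwise.
\<close>

definition perform :: "nat \<Rightarrow> nat \<Rightarrow> nat" where
  "perform s st =
     (if st_count st < 2
      then mk_state (st_stack st) s (Suc (st_loss st)) 0 (Suc (st_len st)) (st_out st + st_count st * 2 ^ st_len st)
      else mk_state (push (req (st_count st - 2) 0 s (st_loss st + 2)) (st_stack st)) s (st_loss st + 2) 0 (st_len st) (st_out st))"

text \<open>
  The symbol transmitted by a piece of length \<open>Suc (m + d)\<close> is \<open>0\<close> if it is the leftmost and \<open>1\<close> if
  it is the rightmost piece on which the closed set still looks dense enough. If the top requirement
  is seen to be violated, its \<open>k\<close> was too small and is increased; everything pushed above a violated
  requirement is discarded. The output is never withdrawn.
\<close>

definition step :: "nat \<Rightarrow> nat \<Rightarrow> nat \<Rightarrow> nat" where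
  "step s x st =
     (if any_suffix (violated s x) (stack_tl (st_stack st))
      then mk_state (stack_tl (st_stack st)) (st_base st) (st_loss st) (st_count st) (st_len st) (st_out st)
      else if st_stack st \<noteq> 0 \<and> violated s x (st_stack st)
      then mk_state (push (req (reqI (stack_hd (st_stack st))) (Suc (reqK (stack_hd (st_stack st))))
                (reqM (stack_hd (st_stack st))) (reqD (stack_hd (st_stack st)))) (stack_tl (st_stack st)))
             s (reqD (stack_hd (st_stack st))) 0 (st_len st) (st_out st)
      else if s < Suc (st_base st + st_loss st) then st
      else if leftmost s x (st_stack st) (st_base st) (st_loss st)
      then mk_state (st_stack st) s (Suc (st_loss st)) (Suc (st_count st)) (st_len st) (st_out st)
      else if rightmost s x (st_stack st) (st_base st) (st_loss st) then perform s st
      else st)"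

text \<open>Stage number and prefix length coincide, so the state at stage \<open>n\<close> depends
  on the first \<open>n\<close> bits only.\<close>

definition run_state :: "cantor \<Rightarrow> nat \<Rightarrow> nat" where
  "run_state X n = rec_nat (mk_state 0 0 0 0 0 0) (\<lambda>i st. step (Suc i) (prefix_num X (Suc i)) st) n"

lemma run_state_0 [simp]: "run_state X 0 = mk_state 0 0 0 0 0 0"
  and run_state_Suc [simp]: "run_state X (Suc n) = step (Suc n) (prefix_num X (Suc n)) (run_state X n)"
  by (simp_all add: run_state_def)

section \<open>Computability of the decoder\<close>

lemma computable_stack_tl [computable_intros]: "computable A f \<Longrightarrow> computable A (\<lambda>x. stack_tl (f x))"
  and computable_stack_hd [computable_intros]: "computable A f \<Longrightarrow> computable A (\<lambda>x. stack_hd (f x))"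
  and computable_push [computable_intros]: "computable A f \<Longrightarrow> computable A g \<Longrightarrow> computable A (\<lambda>x. push (f x) (g x))"
  and computable_reqI [computable_intros]: "computable A f \<Longrightarrow> computable A (\<lambda>x. reqI (f x))"
  and computable_reqK [computable_intros]: "computable A f \<Longrightarrow> computable A (\<lambda>x. reqK (f x))"
  and computable_reqM [computable_intros]: "computable A f \<Longrightarrow> computable A (\<lambda>x. reqM (f x))"
  and computable_reqD [computable_intros]: "computable A f \<Longrightarrow> computable A (\<lambda>x. reqD (f x))"
  and computable_st_stack [computable_intros]: "computable A f \<Longrightarrow> computable A (\<lambda>x. st_stack (f x))"
  and computable_st_base [computable_intros]: "computable A f \<Longrightarrow> computable A (\<lambda>x. st_base (f x))"
  and computable_st_loss [computable_intros]: "computable A f \<Longrightarrow> computable A (\<lambda>x. st_loss (f x))"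
  and computable_st_count [computable_intros]: "computable A f \<Longrightarrow> computable A (\<lambda>x. st_count (f x))"
  and computable_st_len [computable_intros]: "computable A f \<Longrightarrow> computable A (\<lambda>x. st_len (f x))"
  and computable_st_out [computable_intros]: "computable A f \<Longrightarrow> computable A (\<lambda>x. st_out (f x))"
  unfolding stack_tl_def stack_hd_def push_def reqI_def reqK_def reqM_def reqD_def
    st_stack_def st_base_def st_loss_def st_count_def st_len_def st_out_def
  by (intro computable_intros; assumption)+

lemma computable_req [computable_intros]:
  assumes "computable A f" "computable A g" "computable A h" "computable A k"
  shows "computable A (\<lambda>x. req (f x) (g x) (h x) (k x))"
  unfolding req_def by (intro computable_intros assms)

lemma computable_mk_state [computable_intros]:
  assumes "computable A f" "computable A g" "computable A h" "computable A k" "computable A l" "computable A v"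
  shows "computable A (\<lambda>x. mk_state (f x) (g x) (h x) (k x) (l x) (v x))"
  unfolding mk_state_def by (intro computable_intros assms)

lemma decidable_any_suffix [computable_intros]:
  assumes "decidable A (\<lambda>z. P (pfst z) (psnd z))" "computable A c"
  shows "decidable A (\<lambda>x. any_suffix (P x) (c x))"
proof -
  have "decidable A (\<lambda>z. P (pfst (pfst z)) ((stack_tl ^^ psnd z) (psnd (pfst z))))"
    using decidable_compose[OF assms(1), of "\<lambda>z. prod_encode (pfst (pfst z), (stack_tl ^^ psnd z) (psnd (pfst z)))"]
    by (simp add: computable_intros)
  then have "decidable A (\<lambda>z. any_suffix (P (pfst z)) (psnd z))"
    unfolding any_suffix_def by (intro computable_intros)
  from decidable_compose[OF this computable_pair[OF computable_id assms(2)]] show ?thesis by simp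
qed

lemma decidable_in_W [computable_intros]:
  assumes "computable A f" "computable A g" "computable A h"
  shows "decidable A (\<lambda>x. in_W (f x) (g x) (h x))"
proof -
  have "decidable A (\<lambda>z. in_W (pfst z) (pfst (psnd z)) (psnd (psnd z)))"
    unfolding in_W_def by (intro computable_intros)
  from decidable_compose[OF this computable_pair[OF assms(1) computable_pair[OF assms(2,3)]]] show ?thesis by simp
qed

lemma decidable_dense_off_at [computable_intros]:
  assumes "computable A f" "computable A g" "computable A h" "computable A k" "computable A l"
  shows "decidable A (\<lambda>x. dense_off_at (f x) (g x) (h x) (k x) (l x))"
proof -
  have "decidable A (\<lambda>z. dense_off_at (pfst z) (pfst (psnd z)) (pfst (psnd (psnd z))) (pfst (psnd (psnd (psnd z)))) (psnd (psnd (psnd (psnd z)))))"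
    unfolding dense_off_at_def by (intro computable_intros)
  from decidable_compose[OF this computable_pair[OF assms(1) computable_pair[OF assms(2) computable_pair[OF assms(3)
          computable_pair[OF assms(4,5)]]]]]
  show ?thesis by simp
qed

lemma decidable_violated [computable_intros]:
  assumes "computable A f" "computable A g" "computable A h"
  shows "decidable A (\<lambda>x. violated (f x) (g x) (h x))"
  unfolding violated_def by (intro computable_intros assms)

lemma decidable_leftmost: "decidable A (\<lambda>z. leftmost (pfst z) (pfst (psnd z)) (pfst (psnd (psnd z)))
    (pfst (psnd (psnd (psnd z)))) (psnd (psnd (psnd (psnd z)))))"
  and decidable_rightmost: "decidable A (\<lambda>z. rightmost (pfst z) (pfst (psnd z)) (pfst (psnd (psnd z)))
    (pfst (psnd (psnd (psnd z)))) (psnd (psnd (psnd (psnd z)))))"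
  unfolding leftmost_def rightmost_def by (intro computable_intros)+

lemma decidable_leftmost_rightmost [computable_intros]:
  assumes "computable A f" "computable A g" "computable A h" "computable A k" "computable A l"
  shows "decidable A (\<lambda>x. leftmost (f x) (g x) (h x) (k x) (l x))"
    "decidable A (\<lambda>x. rightmost (f x) (g x) (h x) (k x) (l x))"
  using decidable_compose[OF decidable_leftmost computable_pair[OF assms(1) computable_pair[OF assms(2) computable_pair[OF assms(3)
          computable_pair[OF assms(4,5)]]]]]
    decidable_compose[OF decidable_rightmost computable_pair[OF assms(1) computable_pair[OF assms(2) computable_pair[OF assms(3)
          computable_pair[OF assms(4,5)]]]]]
  by simp_all

lemma computable_step [computable_intros]:
  assumes "computable A f" "computable A g" "computable A h"
  shows "computable A (\<lambda>x. step (f x) (g x) (h x))"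
proof -
  have "computable A (\<lambda>z. step (pfst z) (pfst (psnd z)) (psnd (psnd z)))"
    unfolding step_def perform_def by (intro computable_intros)
  from computable_compose[OF this computable_pair[OF assms(1) computable_pair[OF assms(2,3)]]] show ?thesis by simp
qed

lemma computable_run_state: "computable A f \<Longrightarrow> computable A (\<lambda>x. run_state A (f x))"
  unfolding run_state_def by (intro computable_intros computable_prefix_num)

section \<open>Monotonicity of the output\<close>

lemma step_output:
  "st_len st \<le> st_len (step s x st) \<and>
   (st_out st < 2 ^ st_len st \<longrightarrow>
      st_out (step s x st) < 2 ^ st_len (step s x st) \<and> st_out (step s x st) mod 2 ^ st_len st = st_out st)"
proof -
  have "st_count st < 2 \<Longrightarrow> st_count st = 0 \<or> st_count st = 1" by auto
  then show ?thesis by (auto simp: step_def perform_def)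
qed

lemma run_state_output_less: "st_out (run_state X n) < 2 ^ st_len (run_state X n)"
  by (induction n) (use step_output in auto)

lemma run_state_output_mono:
  assumes "n \<le> n'"
  shows "st_len (run_state X n) \<le> st_len (run_state X n')"
    and "st_out (run_state X n') mod 2 ^ st_len (run_state X n) = st_out (run_state X n)"
proof -
  have "st_len (run_state X n) \<le> st_len (run_state X n') \<and>
      st_out (run_state X n') mod 2 ^ st_len (run_state X n) = st_out (run_state X n)"
    using assms
  proof (induction n' rule: dec_induct)
    case base
    show ?case using run_state_output_less by simp
  next
    case (step k)
    let ?l = "st_len (run_state X n)" and ?l' = "st_len (run_state X k)"
    have le: "?l' \<le> st_len (run_state X (Suc k))" and "st_out (run_state X (Suc k)) mod 2 ^ ?l' = st_out (run_state X k)"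
      using step_output run_state_output_less by auto
    then have "st_out (run_state X (Suc k)) mod 2 ^ ?l' mod 2 ^ ?l = st_out (run_state X n)"
      using step by simp
    moreover have "st_out (run_state X (Suc k)) mod 2 ^ ?l' mod 2 ^ ?l = st_out (run_state X (Suc k)) mod 2 ^ ?l"
      using step by (intro mod_mod_cancel) (simp add: le_imp_power_dvd)
    ultimately show ?case using step le by auto
  qed
  then show "st_len (run_state X n) \<le> st_len (run_state X n')"
    and "st_out (run_state X n') mod 2 ^ st_len (run_state X n) = st_out (run_state X n)"
    by auto
qed

text \<open>Bit \<open>n\<close> is read off at the first stage with more than \<open>n\<close>
  output bits; by the second assumption every such stage shows the same bit.\<close>

lemma computes_output:
  assumes "\<And>n. \<exists>s. n < st_len (run_state X s)"
    and "\<And>s. prefix_num Y (st_len (run_state X s)) = st_out (run_state X s)"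
  shows "computes X Y"
proof -
  have decidable: "decidable X (\<lambda>z. pfst z < st_len (run_state X (psnd z)))"
    by (intro computable_intros computable_run_state)
  have "computable X (\<lambda>n. LEAST s. n < st_len (run_state X s))"
    by (rule computable_Least[OF decidable assms(1)])
  then have "computable X (\<lambda>n. of_bool (n \<in> set_decode (st_out (run_state X (LEAST s. n < st_len (run_state X s))))))"
    by (intro computable_intros computable_run_state)
  moreover have "n \<in> set_decode (st_out (run_state X (LEAST s. n < st_len (run_state X s)))) \<longleftrightarrow> Y n" for n
    using LeastI_ex[OF assms(1)[of n]] by (simp add: assms(2)[symmetric] set_decode_prefix_num)
  ultimately show ?thesis
    by (simp add: computes_def computable_def)
qed

section \<open>Relative density of closed sets\<close>

interpretation cantor: prob_space cantor_measure
proof -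
  interpret product_prob_space "\<lambda>_::nat. measure_pmf (bernoulli_pmf (1/2))" UNIV
    by unfold_locales
  show "prob_space cantor_measure"
    unfolding cantor_measure_def by unfold_locales
qed

lemma space_cantor [simp]: "space cantor_measure = UNIV"
  by (simp add: cantor_measure_def space_PiM)

section \<open>Measure of sets determined by a prefix\<close>

lemma prefix_num_eq_cylinder: "{Z. prefix_num Z n = prefix_num X n} = cylinder (map X [0..<n])"
  by (auto simp: prefix_num_eq_iff cylinder_def)

lemma sets_prefix_num_eq: "{Z. prefix_num Z n = v} \<in> sets cantor_measure"
proof (cases "v < 2 ^ n")
  case True
  then obtain X where "prefix_num X n = v" by (rule prefix_num_surj)
  then show ?thesis using sets_cylinder[of "map X [0..<n]"] by (metis prefix_num_eq_cylinder)
next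
  case False
  then have "{Z. prefix_num Z n = v} = {}" using prefix_num_less by blast
  then show ?thesis by simp
qed

lemma measure_prefix_num_eq:
  assumes "v < 2 ^ n"
  shows "measure cantor_measure {Z. prefix_num Z n = v} = 1 / 2 ^ n"
proof -
  obtain X where X: "prefix_num X n = v" using assms by (rule prefix_num_surj)
  have "emeasure cantor_measure (cylinder (map X [0..<n])) = ennreal ((1 / 2) ^ n)"
    by (simp add: emeasure_cylinder)
  then have "measure cantor_measure (cylinder (map X [0..<n])) = (1 / 2) ^ n"
    by (simp add: measure_def)
  then show ?thesis
    by (simp add: X[symmetric] prefix_num_eq_cylinder power_divide)
qed

lemma prefix_num_split: "{Z. P (prefix_num Z s)} = (\<Union>v\<in>{v. v < 2 ^ s \<and> P v}. {Z. prefix_num Z s = v})"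
  by (auto simp: prefix_num_less)

lemma sets_prefix_num: "{Z. P (prefix_num Z s)} \<in> sets cantor_measure"
  unfolding prefix_num_split by (intro sets.countable_UN'' uncountable_def[THEN iffD2] sets_prefix_num_eq) (auto intro: countable_finite)

lemma measure_prefix_num:
  "measure cantor_measure {Z. P (prefix_num Z s)} = real (card {v. v < 2 ^ s \<and> P v}) / 2 ^ s"
proof -
  have "measure cantor_measure {Z. P (prefix_num Z s)} =
      (\<Sum>v\<in>{v. v < 2 ^ s \<and> P v}. measure cantor_measure {Z. prefix_num Z s = v})"
    unfolding prefix_num_split
    by (rule cantor.finite_measure_finite_Union) (auto simp: sets_prefix_num_eq disjoint_family_on_def)
  also have "\<dots> = (\<Sum>v\<in>{v. v < 2 ^ s \<and> P v}. 1 / 2 ^ s)"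
    by (intro sum.cong) (auto simp: measure_prefix_num_eq)
  finally show ?thesis by simp
qed

lemma dense_off_at_iff_measure:
  assumes "m \<le> s"
  shows "dense_off_at c m v d s \<longleftrightarrow>
    1 / 2 ^ (m + d) \<le> measure cantor_measure {Z. prefix_num Z m = v \<and> \<not> in_W c s (prefix_num Z s)}"
proof -
  let ?N = "card {t. t < 2 ^ s \<and> t mod 2 ^ m = v \<and> \<not> in_W c s t}"
  have "{Z. prefix_num Z m = v \<and> \<not> in_W c s (prefix_num Z s)} =
      {Z. prefix_num Z s mod 2 ^ m = v \<and> \<not> in_W c s (prefix_num Z s)}"
    by (simp add: prefix_num_mod[OF assms])
  then have e1: "measure cantor_measure {Z. prefix_num Z m = v \<and> \<not> in_W c s (prefix_num Z s)} = real ?N / 2 ^ s"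
    using measure_prefix_num[of "\<lambda>x. x mod 2 ^ m = v \<and> \<not> in_W c s x" s] by simp
  have e2: "(\<Sum>t<2 ^ s. of_bool (t mod 2 ^ m = v \<and> \<not> in_W c s t)) = ?N"
  proof -
    have "{..<2 ^ s} \<inter> {t. t mod 2 ^ m = v \<and> \<not> in_W c s t} =
        {t. t < 2 ^ s \<and> t mod 2 ^ m = v \<and> \<not> in_W c s t}" by auto
    then show ?thesis by (simp add: sum_of_bool_eq)
  qed
  have e3: "(2 :: nat) ^ s \<le> ?N * 2 ^ (m + d) \<longleftrightarrow> (2 :: real) ^ s \<le> real ?N * 2 ^ (m + d)"
    by (subst of_nat_le_iff[where 'a = real, symmetric])
      (simp only: of_nat_mult of_nat_power of_nat_numeral)
  show ?thesis
    unfolding dense_off_at_def e1 e2 e3 by (simp add: field_simps)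
qed

definition Wset :: "nat \<Rightarrow> cantor set" where
  "Wset c = {X. \<exists>s. in_W c s (prefix_num X s)}"

text \<open>The limit of the stage tests. In a cylinder of measure \<open>1 / 2 ^ m\<close> it
  bounds the relative measure of the closed set from below by \<open>1 / 2 ^ d\<close>.\<close>

definition dense_off :: "nat \<Rightarrow> nat \<Rightarrow> nat \<Rightarrow> nat \<Rightarrow> bool" where
  "dense_off c m v d \<longleftrightarrow> 1 / 2 ^ (m + d) \<le> measure cantor_measure ({Z. prefix_num Z m = v} - Wset c)"

lemma in_W_0 [simp]: "\<not> in_W 0 s v"
  by (simp add: in_W_def)

lemma in_W_cons [simp]:
  "in_W (push e c) s v \<longleftrightarrow> in_V (reqI e) (reqK e) s v \<or> in_W c s v"
  by (simp add: in_W_def)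

lemma in_W_mono: "in_W c s (prefix_num X s) \<Longrightarrow> s \<le> s' \<Longrightarrow> in_W c s' (prefix_num X s')"
  by (induction c rule: stack_induct) (auto dest: in_V_mono)

lemma Wset_0 [simp]: "Wset 0 = {}"
  by (simp add: Wset_def)

lemma Wset_cons [simp]: "Wset (push e c) = Vset (reqI e) (reqK e) \<union> Wset c"
  by (auto simp: Wset_def Vset_def)

lemma sets_Wset: "Wset c \<in> sets cantor_measure"
proof -
  have "Wset c = (\<Union>s. {X. in_W c s (prefix_num X s)})" by (auto simp: Wset_def)
  then show ?thesis using sets_prefix_num by auto
qed

lemma sets_Vset: "Vset i k \<in> sets cantor_measure"
  using sets_Wset[of "push (req i k 0 0) 0"] by simp

lemma dense_off_imp_dense_off_at:
  assumes "dense_off c m v d" "m \<le> s"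
  shows "dense_off_at c m v d s"
proof -
  have "measure cantor_measure ({Z. prefix_num Z m = v} - Wset c) \<le>
      measure cantor_measure {Z. prefix_num Z m = v \<and> \<not> in_W c s (prefix_num Z s)}"
  proof (rule cantor.finite_measure_mono)
    show "{Z. prefix_num Z m = v \<and> \<not> in_W c s (prefix_num Z s)} \<in> cantor.events"
      using sets.Int[OF sets_prefix_num_eq[of m v] sets_prefix_num[of "\<lambda>x. \<not> in_W c s x" s]]
      by (simp add: Int_def)
  qed (auto simp: Wset_def)
  then show ?thesis
    using assms by (simp add: dense_off_at_iff_measure dense_off_def)
qed

text \<open>The stage approximations decrease to the closed set, so by continuity from above their
  measures eventually drop below the threshold and stay there. This makes a wrong guess
  detectable.\<close>

lemma not_dense_off_imp_not_dense_off_at: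
  assumes "\<not> dense_off c m v d"
  shows "\<exists>s0. \<forall>s\<ge>s0. \<not> dense_off_at c m v d s"
proof -
  define B where "B s = {Z. prefix_num Z m = v \<and> \<not> in_W c s (prefix_num Z s)}" for s
  have "B s \<in> cantor.events" for s
    using sets.Int[OF sets_prefix_num_eq[of m v] sets_prefix_num[of "\<lambda>x. \<not> in_W c s x" s]]
    by (simp add: Int_def B_def)
  moreover have "decseq B"
    by (auto simp: decseq_def B_def dest: in_W_mono)
  ultimately have "(\<lambda>s. measure cantor_measure (B s)) \<longlonglongrightarrow> measure cantor_measure (\<Inter>s. B s)"
    by (intro cantor.finite_Lim_measure_decseq) auto
  moreover have "(\<Inter>s. B s) = {Z. prefix_num Z m = v} - Wset c"
    by (auto simp: B_def Wset_def)
  ultimately have "\<forall>\<^sub>F s in sequentially. measure cantor_measure (B s) < 1 / 2 ^ (m + d)"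
    using assms by (intro order_tendstoD(2)) (auto simp: dense_off_def)
  then obtain s0 where "\<And>s. s \<ge> s0 \<Longrightarrow> measure cantor_measure (B s) < 1 / 2 ^ (m + d)"
    by (auto simp: eventually_sequentially)
  then have "\<forall>s\<ge>max s0 m. \<not> dense_off_at c m v d s"
    by (simp add: dense_off_at_iff_measure B_def not_le)
  then show ?thesis by blast
qed

lemma dense_off_extend:
  assumes "dense_off c n v d"
  shows "\<exists>b. dense_off c (Suc n) (v + of_bool b * 2 ^ n) d"
proof (rule ccontr)
  assume neg: "\<nexists>b. dense_off c (Suc n) (v + of_bool b * 2 ^ n) d"
  let ?A = "\<lambda>b. {Z. prefix_num Z (Suc n) = v + of_bool b * 2 ^ n} - Wset c"
  have "{Z. prefix_num Z n = v} - Wset c \<subseteq> ?A False \<union> ?A True"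
    by auto
  then have "measure cantor_measure ({Z. prefix_num Z n = v} - Wset c) \<le>
      measure cantor_measure (?A False \<union> ?A True)"
    by (intro cantor.finite_measure_mono sets.Un sets.Diff sets_prefix_num_eq sets_Wset)
  also have "\<dots> \<le> measure cantor_measure (?A False) + measure cantor_measure (?A True)"
    by (intro measure_Un_le sets.Diff sets_prefix_num_eq sets_Wset)
  also have "\<dots> < 1 / 2 ^ (Suc n + d) + 1 / 2 ^ (Suc n + d)"
    using neg unfolding dense_off_def not_ex not_le by (intro add_strict_mono) blast+
  finally show False using assms by (simp add: dense_off_def field_simps)
qed

text \<open>By averaging, one half of a cylinder inherits the relative density. Hence waiting along
  a suitable path costs nothing: \<open>d\<close> stays fixed.\<close>

lemma dense_off_path:
  assumes "dense_off c n v d" "v < 2 ^ n"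
  obtains X where "prefix_num X n = v" "\<And>n'. n' \<ge> n \<Longrightarrow> dense_off c n' (prefix_num X n') d"
proof -
  obtain X0 where X0: "prefix_num X0 n = v" using assms(2) by (rule prefix_num_surj)
  define B where "B i w = (if i < n then X0 i
    else SOME b. dense_off c (Suc i) (w + of_bool b * 2 ^ i) d)" for i w
  define w where "w = rec_nat 0 (\<lambda>i w. w + of_bool (B i w) * 2 ^ i)"
  define X where "X i = B i (w i)" for i
  have prefix_num_X: "prefix_num X i = w i" for i
    by (induction i) (simp_all add: w_def X_def)
  have "prefix_num X n = v"
    by (simp add: X0[symmetric] prefix_num_eq_iff X_def B_def)
  moreover have "dense_off c n' (prefix_num X n') d" if "n' \<ge> n" for n'
    using that
  proof (induction n' rule: dec_induct)
    case base
    show ?case using assms(1) \<open>prefix_num X n = v\<close> by simp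
  next
    case (step i)
    then have "X i = (SOME b. dense_off c (Suc i) (prefix_num X i + of_bool b * 2 ^ i) d)"
      by (simp add: X_def B_def prefix_num_X)
    then show ?case
      using someI_ex[OF dense_off_extend[OF step(3)]] by simp
  qed
  ultimately show thesis by (rule that)
qed

lemma card_pieces:
  fixes v :: nat
  assumes "v < 2 ^ n" "n \<le> M"
  shows "card {u. u < 2 ^ M \<and> u mod 2 ^ n = v} = 2 ^ (M - n)"
proof -
  have "real (card {u. u < 2 ^ M \<and> u mod 2 ^ n = v}) / 2 ^ M = 1 / 2 ^ n"
    using measure_prefix_num[of "\<lambda>u. u mod 2 ^ n = v" M] measure_prefix_num_eq[OF assms(1)] assms(2)
    by (simp add: prefix_num_mod)
  then have "real (card {u. u < 2 ^ M \<and> u mod 2 ^ n = v}) = 2 ^ (M - n)"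
    using assms(2) by (simp add: field_simps power_diff)
  then show ?thesis
    by (metis of_nat_eq_iff of_nat_numeral of_nat_power)
qed

text \<open>
  Pieces have length \<open>Suc (n + d)\<close>, so that a single good piece together with bad ones cannot carry the
  measure \<open>2 ^ - (n + d)\<close>. Hence the leftmost and the rightmost good piece differ.
\<close>

lemma two_good_pieces:
  assumes "dense_off c n v d" "v < 2 ^ n"
  shows "2 \<le> card {u. u < 2 ^ Suc (n + d) \<and> u mod 2 ^ n = v \<and> dense_off c (Suc (n + d)) u (Suc d)}"
proof (rule ccontr)
  let ?M = "Suc (n + d)"
  let ?A = "{u. u < 2 ^ ?M \<and> u mod 2 ^ n = v}"
  let ?G = "{u. u < 2 ^ ?M \<and> u mod 2 ^ n = v \<and> dense_off c ?M u (Suc d)}"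
  let ?\<mu> = "\<lambda>u. measure cantor_measure ({Z. prefix_num Z ?M = u} - Wset c)"
  assume "\<not> 2 \<le> card ?G"
  then have G: "real (card ?G) \<le> 1" by linarith
  have cardA: "card ?A = 2 ^ Suc d"
    using card_pieces[OF assms(2), of ?M] by simp
  have "{Z. prefix_num Z n = v} - Wset c = (\<Union>u\<in>?A. {Z. prefix_num Z ?M = u} - Wset c)"
    using prefix_num_less[of _ ?M] by (auto simp: prefix_num_mod simp del: prefix_num.simps power_Suc)
  then have "measure cantor_measure ({Z. prefix_num Z n = v} - Wset c) = (\<Sum>u\<in>?A. ?\<mu> u)"
    by (simp only:) (rule cantor.finite_measure_finite_Union,
      auto simp: disjoint_family_on_def simp del: prefix_num.simps intro!: sets.Diff sets_prefix_num_eq sets_Wset)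
  \<comment> \<open>A bad piece carries at most the threshold, a good one at most its full
    measure.\<close>
  also have "\<dots> \<le> (\<Sum>u\<in>?A. 1 / 2 ^ (?M + Suc d) + of_bool (u \<in> ?G) * (1 / 2 ^ ?M - 1 / 2 ^ (?M + Suc d)))"
  proof (rule sum_mono)
    fix u assume u: "u \<in> ?A"
    show "?\<mu> u \<le> 1 / 2 ^ (?M + Suc d) + of_bool (u \<in> ?G) * (1 / 2 ^ ?M - 1 / 2 ^ (?M + Suc d))"
    proof (cases "u \<in> ?G")
      case True
      have "?\<mu> u \<le> measure cantor_measure {Z. prefix_num Z ?M = u}"
        by (intro cantor.finite_measure_mono sets_prefix_num_eq) auto
      then show ?thesis using True u by (simp add: measure_prefix_num_eq del: prefix_num.simps)
    next
      case False
      then have "\<not> dense_off c ?M u (Suc d)" using u by blast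
      then show ?thesis using False by (simp add: dense_off_def del: prefix_num.simps)
    qed
  qed
  also have "\<dots> = real (card ?A) / 2 ^ (?M + Suc d) +
      real (card ?G) * (1 / 2 ^ ?M - 1 / 2 ^ (?M + Suc d))"
  proof -
    have "?A \<inter> {u. u \<in> ?G} = ?G" by auto
    then have "(\<Sum>u\<in>?A. of_bool (u \<in> ?G)) = real (card ?G)"
      by (subst sum_of_bool_eq) (simp_all add: Int_def conj_ac)
    then show ?thesis
      by (simp only: sum.distrib sum_distrib_right[symmetric] sum_constant) simp
  qed
  also have "\<dots> \<le> real (card ?A) / 2 ^ (?M + Suc d) + 1 * (1 / 2 ^ ?M - 1 / 2 ^ (?M + Suc d))"
    by (intro add_left_mono mult_right_mono G)
      (simp only: diff_ge_0_iff_ge, intro divide_left_mono power_increasing; simp)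
  \<comment> \<open>All \<open>2 ^ Suc d\<close> thresholds together make up one full piece, and two
    full pieces make up \<open>1 / 2 ^ (n + d)\<close>; the subtracted threshold gives
    strictness.\<close>
  also have "\<dots> = 1 / 2 ^ ?M + (1 / 2 ^ ?M - 1 / 2 ^ (?M + Suc d))"
    unfolding cardA power_add[of 2 ?M "Suc d"] by simp
  also have "\<dots> < 1 / 2 ^ (n + d)"
    by simp
  finally show False using assms(1) by (simp add: dense_off_def)
qed

lemma Vset_antimono: "k \<le> k' \<Longrightarrow> Vset i k' \<subseteq> Vset i k"
  unfolding Vset_def in_V_def by (auto, metis less_Suc_eq_le less_le_trans not_less_eq)

text \<open>The sets \<open>Vset i k\<close> decrease to a null set, so some \<open>k\<close>
  removes less than half of the guaranteed measure; this half is the increment of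
  \<open>d\<close>.\<close>

lemma dense_off_push:
  assumes "dense_off c n v d" "(\<Inter>k. Vset i k) \<in> null_sets cantor_measure"
  shows "\<exists>k. dense_off (push (req i k m' d') c) n v (Suc d)"
proof -
  have "(\<lambda>k. measure cantor_measure (Vset i k)) \<longlonglongrightarrow> measure cantor_measure (\<Inter>k. Vset i k)"
    by (intro cantor.finite_Lim_measure_decseq) (auto simp: decseq_def sets_Vset dest: Vset_antimono)
  moreover have "measure cantor_measure (\<Inter>k. Vset i k) = 0"
    using assms(2) by (simp add: null_sets_def measure_def)
  ultimately have "\<forall>\<^sub>F k in sequentially. measure cantor_measure (Vset i k) < 1 / 2 ^ (n + Suc d)"
    by (intro order_tendstoD(2)) auto
  then obtain k where k: "measure cantor_measure (Vset i k) < 1 / 2 ^ (n + Suc d)"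
    by (auto simp: eventually_sequentially)
  let ?W = "Wset (push (req i k m' d') c)"
  have "measure cantor_measure ({Z. prefix_num Z n = v} - Wset c) \<le>
      measure cantor_measure (({Z. prefix_num Z n = v} - ?W) \<union> Vset i k)"
    by (intro cantor.finite_measure_mono sets.Un sets.Diff sets_prefix_num_eq sets_Wset sets_Vset) auto
  also have "\<dots> \<le> measure cantor_measure ({Z. prefix_num Z n = v} - ?W) + measure cantor_measure (Vset i k)"
    by (intro measure_Un_le sets.Diff sets_prefix_num_eq sets_Wset sets_Vset)
  finally have "1 / 2 ^ (n + d) \<le> measure cantor_measure ({Z. prefix_num Z n = v} - ?W) + 1 / 2 ^ (n + Suc d)"
    using assms(1) k unfolding dense_off_def by linarith
  then have "dense_off (push (req i k m' d') c) n v (Suc d)"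
    unfolding dense_off_def by (simp add: field_simps)
  then show ?thesis by blast
qed

lemma dense_off_not_subset: "dense_off c n v d \<Longrightarrow> \<not> {Z. prefix_num Z n = v} \<subseteq> Wset c"
proof
  assume G: "dense_off c n v d" and "{Z. prefix_num Z n = v} \<subseteq> Wset c"
  then have "{Z. prefix_num Z n = v} - Wset c = {}" by blast
  with G have "1 / 2 ^ (n + d) \<le> (0 :: real)" unfolding dense_off_def by (simp only: measure_empty)
  then show False by (simp add: divide_le_0_iff) (metis not_le zero_less_numeral zero_less_power)
qed

section \<open>Steering the decoder\<close>

lemma prefix_num_agree: "prefix_num X' n = prefix_num X n \<Longrightarrow> m \<le> n \<Longrightarrow> prefix_num X' m = prefix_num X m"
  by (metis prefix_num_mod)

lemma run_state_agree: "prefix_num X' n = prefix_num X n \<Longrightarrow> run_state X' n = run_state X n"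
proof (induction n)
  case (Suc n)
  then show ?case using prefix_num_agree[of X' "Suc n" X n] by (simp del: prefix_num.simps)
qed simp

text \<open>True density in place of its stage approximation: all guesses on the stack are correct,
  and remain so for every sequence with the same first \<open>n\<close> bits.\<close>

definition settled :: "cantor \<Rightarrow> nat \<Rightarrow> nat \<Rightarrow> bool" where
  "settled X n z \<longleftrightarrow> \<not> any_suffix (\<lambda>w. \<not> (reqM (stack_hd w) \<le> n \<and>
     dense_off w (reqM (stack_hd w)) (prefix_num X (reqM (stack_hd w))) (reqD (stack_hd w)))) z"

lemma settled_0 [simp]: "settled X n 0"
  by (simp add: settled_def)

lemma settled_cons [simp]: "settled X n (push e c) \<longleftrightarrow>
    reqM e \<le> n \<and> dense_off (push e c) (reqM e) (prefix_num X (reqM e)) (reqD e) \<and> settled X n c"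
  by (simp add: settled_def)

lemma settled_agree:
  assumes "settled X n z" "prefix_num X' n = prefix_num X n" "n \<le> n'"
  shows "settled X' n' z"
  using assms(1)
proof (induction z rule: stack_induct)
  case (cons e c)
  then show ?case using assms(3) prefix_num_agree[OF assms(2)] by auto
qed simp

lemma settled_not_violated:
  assumes "settled X n z" "n \<le> s"
  shows "\<not> any_suffix (violated s (prefix_num X s)) z"
  using assms(1)
proof (induction z rule: stack_induct)
  case (cons e c)
  then show ?case using assms(2) by (auto simp: violated_def prefix_num_mod intro: dense_off_imp_dense_off_at)
qed simp

lemma leftmost_iff: "Suc (m + d) \<le> s \<Longrightarrow> leftmost s (prefix_num X s) z m d \<longleftrightarrow>
    (\<forall>v<prefix_num X (Suc (m + d)). v mod 2 ^ m = prefix_num X m \<longrightarrow> \<not> dense_off_at z (Suc (m + d)) v (Suc d) s)"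
  and rightmost_iff: "Suc (m + d) \<le> s \<Longrightarrow> rightmost s (prefix_num X s) z m d \<longleftrightarrow>
    (\<forall>v<2 ^ Suc (m + d). prefix_num X (Suc (m + d)) < v \<longrightarrow> v mod 2 ^ m = prefix_num X m \<longrightarrow>
      \<not> dense_off_at z (Suc (m + d)) v (Suc d) s)"
  by (simp_all only: leftmost_def rightmost_def prefix_num_mod)

lemma step_quiet:
  assumes "settled X n z" "n \<le> s"
  shows "step s (prefix_num X s) (mk_state z n d j l v) =
    (if s < Suc (n + d) then mk_state z n d j l v
     else if leftmost s (prefix_num X s) z n d then mk_state z s (Suc d) (Suc j) l v
     else if rightmost s (prefix_num X s) z n d then perform s (mk_state z n d j l v)
     else mk_state z n d j l v)"
proof -
  have nv: "\<not> any_suffix (violated s (prefix_num X s)) z" by (rule settled_not_violated[OF assms])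
  then have "\<not> any_suffix (violated s (prefix_num X s)) (stack_tl z)" using any_suffix_tl by blast
  moreover have "\<not> (z \<noteq> 0 \<and> violated s (prefix_num X s) z)"
    using nv by (metis any_suffix_cons push_hd_tl)
  ultimately show ?thesis unfolding step_def by (simp only: mk_state_simps if_False)
qed

lemma wait:
  assumes st: "run_state X n = mk_state z n d j l v" and settled: "settled X n z"
    and fires: "\<exists>s\<ge>Suc (n + d). leftmost s (prefix_num X s) z n d \<or> rightmost s (prefix_num X s) z n d"
  shows "\<exists>n'\<ge>Suc (n + d). (leftmost n' (prefix_num X n') z n d \<or> rightmost n' (prefix_num X n') z n d) \<and>
    run_state X n' = (if leftmost n' (prefix_num X n') z n d then mk_state z n' (Suc d) (Suc j) l v
      else perform n' (mk_state z n d j l v))"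
proof -
  define P where "P s \<longleftrightarrow> Suc (n + d) \<le> s \<and> (leftmost s (prefix_num X s) z n d \<or> rightmost s (prefix_num X s) z n d)" for s
  define n' where "n' = (LEAST s. P s)"
  have P: "P n'" unfolding n'_def by (rule LeastI_ex) (use fires in \<open>auto simp: P_def\<close>)
  have less: "\<not> P s" if "s < n'" for s using that not_less_Least unfolding n'_def by blast
  have quiet: "run_state X s = mk_state z n d j l v" if "n \<le> s" "s < n'" for s
    using that
  proof (induction s rule: dec_induct)
    case base
    then show ?case using st by simp
  next
    case (step s)
    have "\<not> P (Suc s)" using step less by blast
    then show ?case using step step_quiet[OF settled, of "Suc s" d j l v]
      by (auto simp: P_def simp del: prefix_num.simps)
  qed
  obtain p where p: "n' = Suc p" "n \<le> p" using P by (cases n') (auto simp: P_def)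
  have "run_state X n' = step n' (prefix_num X n') (mk_state z n d j l v)"
    using quiet[of p] p by (simp del: prefix_num.simps)
  also have "\<dots> = (if leftmost n' (prefix_num X n') z n d then mk_state z n' (Suc d) (Suc j) l v
      else perform n' (mk_state z n d j l v))"
    using step_quiet[OF settled, of n' d j l v] P p by (auto simp: P_def simp del: prefix_num.simps)
  finally show ?thesis using P by (auto simp: P_def)
qed

text \<open>Aim at the first or last truly good piece. Its bad competitors are eventually exposed,
  so the intended symbol is recognized; the opposite symbol never is, because the other extreme good
  piece looks dense at every stage.\<close>

lemma send:
  assumes st: "run_state X n = mk_state z n d j l v" and settled: "settled X n z" and G: "dense_off z n (prefix_num X n) d"
  shows "\<exists>X' n'. n < n' \<and> prefix_num X' n = prefix_num X n \<and> dense_off z n' (prefix_num X' n') (Suc d) \<and>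
    run_state X' n' = (if b then perform n' (mk_state z n d j l v) else mk_state z n' (Suc d) (Suc j) l v)"
proof -
  let ?M = "Suc (n + d)"
  define A where "A = {u. u < 2 ^ ?M \<and> u mod 2 ^ n = prefix_num X n \<and> dense_off z ?M u (Suc d)}"
  have "finite A" by (simp add: A_def)
  have "2 \<le> card A" unfolding A_def by (rule two_good_pieces[OF G prefix_num_less])
  then have "A \<noteq> {}" by auto
  have "Min A < Max A"
  proof (rule ccontr)
    assume "\<not> Min A < Max A"
    then have "A \<subseteq> {Min A}"
      using \<open>finite A\<close> Min_le[OF \<open>finite A\<close>] Max_ge[OF \<open>finite A\<close>]
      by (metis antisym le_trans linorder_not_less singleton_iff subsetI)
    then have "card A \<le> 1" using card_mono[of "{Min A}" A] by simp
    with \<open>2 \<le> card A\<close> show False by simp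
  qed
  define u where "u = (if b then Max A else Min A)"
  have "u \<in> A" using \<open>finite A\<close> \<open>A \<noteq> {}\<close> by (simp add: u_def)
  then obtain X' where X': "prefix_num X' ?M = u" "\<And>n'. n' \<ge> ?M \<Longrightarrow> dense_off z n' (prefix_num X' n') (Suc d)"
    using dense_off_path[of z ?M u "Suc d"] by (auto simp: A_def)
  have prefix_num': "prefix_num X' n = prefix_num X n"
    using prefix_num_mod[of n ?M X'] X'(1) \<open>u \<in> A\<close> by (simp add: A_def del: prefix_num.simps)
  have st': "run_state X' n = mk_state z n d j l v" using st run_state_agree[OF prefix_num'] by simp
  have settled': "settled X' n z" by (rule settled_agree[OF settled prefix_num']) simp
  have bad: "\<exists>s0. \<forall>s\<ge>s0. \<not> dense_off_at z ?M w (Suc d) s"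
    if "w < 2 ^ ?M" "w mod 2 ^ n = prefix_num X' n" "w \<notin> A" for w
    using that not_dense_off_imp_not_dense_off_at by (auto simp: A_def prefix_num')
  have good: "dense_off_at z ?M w (Suc d) s" "w < 2 ^ ?M" "w mod 2 ^ n = prefix_num X' n"
    if "w \<in> A" "s \<ge> ?M" for w s
    using that by (auto simp: A_def prefix_num' intro: dense_off_imp_dense_off_at)
  have "\<forall>w. \<exists>s0. w < 2 ^ ?M \<and> w mod 2 ^ n = prefix_num X' n \<and> w \<notin> A \<longrightarrow>
      (\<forall>s\<ge>s0. \<not> dense_off_at z ?M w (Suc d) s)"
    using bad by blast
  then obtain t where t: "\<And>w s. w < 2 ^ ?M \<Longrightarrow> w mod 2 ^ n = prefix_num X' n \<Longrightarrow> w \<notin> A \<Longrightarrow>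
      t w \<le> s \<Longrightarrow> \<not> dense_off_at z ?M w (Suc d) s"
    by metis
  \<comment> \<open>By this stage all bad pieces are exposed.\<close>
  define s where "s = ?M + (\<Sum>w<2 ^ ?M. t w)"
  have ts: "t w \<le> s" if "w < 2 ^ ?M" for w
    using that member_le_sum[of w "{..<2 ^ ?M}" t] by (simp add: s_def)
  show ?thesis
  proof (cases b)
    case True
    then have u: "u = Max A" by (simp add: u_def)
    have "rightmost s (prefix_num X' s) z n d"
    proof (subst rightmost_iff)
      show "\<forall>w<2 ^ ?M. prefix_num X' ?M < w \<longrightarrow> w mod 2 ^ n = prefix_num X' n \<longrightarrow> \<not> dense_off_at z ?M w (Suc d) s"
        using t ts Max_ge[OF \<open>finite A\<close>] unfolding X' u by (meson leD)
    qed (simp add: s_def)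
    then have "\<exists>s\<ge>?M. leftmost s (prefix_num X' s) z n d \<or> rightmost s (prefix_num X' s) z n d"
      by (intro exI[of _ s]) (simp add: s_def)
    from wait[OF st' settled' this] obtain n' where n': "n' \<ge> ?M"
      "run_state X' n' = (if leftmost n' (prefix_num X' n') z n d then mk_state z n' (Suc d) (Suc j) l v
        else perform n' (mk_state z n d j l v))" by blast
    \<comment> \<open>The decoder may react before stage \<open>s\<close>, but \<open>Min A\<close>
      lies to the left and never looks bad.\<close>
    have "\<not> leftmost n' (prefix_num X' n') z n d"
      unfolding leftmost_iff[OF n'(1)] X' u
      using \<open>Min A < Max A\<close> good[OF Min_in[OF \<open>finite A\<close> \<open>A \<noteq> {}\<close>] n'(1)] by blast
    then show ?thesis using True n' prefix_num' X'(2)[OF n'(1)]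
      by (intro exI[of _ X'] exI[of _ n']) auto
  next
    case False
    then have u: "u = Min A" by (simp add: u_def)
    have "u < 2 ^ ?M" using \<open>u \<in> A\<close> by (simp add: A_def)
    have "leftmost s (prefix_num X' s) z n d"
    proof (subst leftmost_iff)
      show "\<forall>w<prefix_num X' ?M. w mod 2 ^ n = prefix_num X' n \<longrightarrow> \<not> dense_off_at z ?M w (Suc d) s"
        using t ts Min_le[OF \<open>finite A\<close>] \<open>u < 2 ^ ?M\<close> unfolding X' u by (meson leD less_trans)
    qed (simp add: s_def)
    then have "\<exists>s\<ge>?M. leftmost s (prefix_num X' s) z n d \<or> rightmost s (prefix_num X' s) z n d"
      by (intro exI[of _ s]) (simp add: s_def)
    from wait[OF st' settled' this] obtain n' where n': "n' \<ge> ?M"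
      "leftmost n' (prefix_num X' n') z n d \<or> rightmost n' (prefix_num X' n') z n d"
      "run_state X' n' = (if leftmost n' (prefix_num X' n') z n d then mk_state z n' (Suc d) (Suc j) l v
        else perform n' (mk_state z n d j l v))" by blast
    have "\<not> rightmost n' (prefix_num X' n') z n d"
      unfolding rightmost_iff[OF n'(1)] X' u
      using \<open>Min A < Max A\<close> good[OF Max_in[OF \<open>finite A\<close> \<open>A \<noteq> {}\<close>] n'(1)] by blast
    then show ?thesis using False n' prefix_num' X'(2)[OF n'(1)]
      by (intro exI[of _ X'] exI[of _ n']) auto
  qed
qed

lemma send_zeros:
  assumes st: "run_state X n = mk_state z n d 0 l v" and settled: "settled X n z" and G: "dense_off z n (prefix_num X n) d"
  shows "\<exists>X' n'. n \<le> n' \<and> prefix_num X' n = prefix_num X n \<and> dense_off z n' (prefix_num X' n') (d + a) \<and>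
    run_state X' n' = mk_state z n' (d + a) a l v"
proof (induction a)
  case 0
  show ?case using st G by (intro exI[of _ X] exI[of _ n]) simp
next
  case (Suc a)
  then obtain X' n' where *: "n \<le> n'" "prefix_num X' n = prefix_num X n" "dense_off z n' (prefix_num X' n') (d + a)"
    "run_state X' n' = mk_state z n' (d + a) a l v" by blast
  from send[OF *(4) settled_agree[OF settled *(2,1)] *(3), of False]
  obtain X'' n'' where "n' < n''" "prefix_num X'' n' = prefix_num X' n'" "dense_off z n'' (prefix_num X'' n'') (Suc (d + a))"
    "run_state X'' n'' = mk_state z n'' (Suc (d + a)) (Suc a) l v" by auto
  then show ?case using * prefix_num_agree[of X'' n' X' n]
    by (intro exI[of _ X''] exI[of _ n'']) auto
qed

lemma send_command:
  assumes st: "run_state X n = mk_state z n d 0 l v" and settled: "settled X n z" and G: "dense_off z n (prefix_num X n) d"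
  shows "\<exists>X' n' m. n < n' \<and> prefix_num X' n = prefix_num X n \<and> dense_off z n' (prefix_num X' n') (Suc (d + a)) \<and>
    run_state X' n' = perform n' (mk_state z m (d + a) a l v)"
proof -
  obtain X' n' where *: "n \<le> n'" "prefix_num X' n = prefix_num X n" "dense_off z n' (prefix_num X' n') (d + a)"
    "run_state X' n' = mk_state z n' (d + a) a l v" using send_zeros[OF assms] by blast
  from send[OF *(4) settled_agree[OF settled *(2,1)] *(3), of True]
  obtain X'' n'' where "n' < n''" "prefix_num X'' n' = prefix_num X' n'" "dense_off z n'' (prefix_num X'' n'') (Suc (d + a))"
    "run_state X'' n'' = perform n'' (mk_state z n' (d + a) a l v)" by auto
  then show ?thesis using * prefix_num_agree[of X'' n' X' n]
    by (intro exI[of _ X''] exI[of _ n''] exI[of _ n']) auto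
qed

text \<open>A position between commands, as the count \<open>0\<close> says. \<open>Y\<close>
  matters only through its first \<open>l\<close> bits and may be replaced beyond them.\<close>

definition good_pos :: "cantor \<Rightarrow> nat \<Rightarrow> nat \<Rightarrow> nat \<Rightarrow> nat \<Rightarrow> cantor \<Rightarrow> bool" where
  "good_pos X n z d l Y \<longleftrightarrow>
     run_state X n = mk_state z n d 0 l (prefix_num Y l) \<and> settled X n z \<and> dense_off z n (prefix_num X n) d"

lemma append_output:
  assumes "good_pos X n z d l Y" "l \<le> l'"
  shows "\<exists>X' n' d'. n \<le> n' \<and> prefix_num X' n = prefix_num X n \<and> good_pos X' n' z d' l' Y"
  using assms(2)
proof (induction l' rule: dec_induct)
  case base
  show ?case using assms(1) by blast
next
  case (step k)
  then obtain X' n' d' where *: "n \<le> n'" "prefix_num X' n = prefix_num X n"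
    "run_state X' n' = mk_state z n' d' 0 k (prefix_num Y k)" "settled X' n' z" "dense_off z n' (prefix_num X' n') d'"
    by (auto simp: good_pos_def)
  obtain X'' n'' m where **: "n' < n''" "prefix_num X'' n' = prefix_num X' n'"
    "dense_off z n'' (prefix_num X'' n'') (Suc (d' + of_bool (Y k)))"
    "run_state X'' n'' = perform n'' (mk_state z m (d' + of_bool (Y k)) (of_bool (Y k)) k (prefix_num Y k))"
    using send_command[OF *(3-5)] by blast
  have "run_state X'' n'' = mk_state z n'' (Suc (d' + of_bool (Y k))) 0 (Suc k) (prefix_num Y (Suc k))"
    using **(4) by (simp add: perform_def)
  moreover have "settled X'' n'' z" using **(1) by (intro settled_agree[OF *(4) **(2)]) simp
  ultimately have "good_pos X'' n'' z (Suc (d' + of_bool (Y k))) (Suc k) Y"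
    using **(3) by (simp add: good_pos_def del: prefix_num.simps)
  moreover have "n \<le> n''" "prefix_num X'' n = prefix_num X n"
    using *(1,2) **(1,2) prefix_num_agree[of X'' n' X' n] by auto
  ultimately show ?case by blast
qed

text \<open>Describes the stack while a wrong guess \<open>w\<close> is in force: anything may have
  been pushed on top of it.\<close>

inductive above :: "nat \<Rightarrow> nat \<Rightarrow> bool" for w where
  refl: "above w w"
| cons: "above w c \<Longrightarrow> above w (push e c)"

lemma above_any_suffix: "above w c \<Longrightarrow> w \<noteq> 0 \<Longrightarrow> P w \<Longrightarrow> any_suffix P c"
proof (induction rule: above.induct)
  case refl
  then show ?case using any_suffix_cons[of P "stack_hd w" "stack_tl w"] by (simp add: push_hd_tl)
qed simp

text \<open>
  For the least sufficient \<open>k\<close>, the path runs inside the final closed set from the start. While \<open>k\<close> is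
  still too small the decoder may output anything and push arbitrary requirements, but only until the
  violation is noticed and the stack above has been drained.
\<close>

lemma push_requirement:
  assumes pos: "good_pos X n z d l Y" and null: "(\<Inter>k. Vset i k) \<in> null_sets cantor_measure"
  shows "\<exists>X' n' k m dd d' l' Y'. n \<le> n' \<and> prefix_num X' n = prefix_num X n \<and>
    good_pos X' n' (push (req i k m dd) z) d' l' Y'"
proof -
  obtain X1 n1 m where 1: "n < n1" "prefix_num X1 n = prefix_num X n"
    "dense_off z n1 (prefix_num X1 n1) (Suc (d + (i + 2)))"
    "run_state X1 n1 = perform n1 (mk_state z m (d + (i + 2)) (i + 2) l (prefix_num Y l))"
    using pos send_command[of X n z d l "prefix_num Y l" "i + 2"] unfolding good_pos_def by blast
  \<comment> \<open>The \<open>i + 2\<close> symbols \<open>0\<close> and the closing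
    \<open>1\<close> cost \<open>i + 3\<close>; one more is the halving in
    \<open>dense_off_push\<close>.\<close>
  define d1 where "d1 = Suc (Suc (Suc (Suc (d + i))))"
  define w where "w k = push (req i k n1 d1) z" for k
  have w_simps: "stack_hd (w k) = req i k n1 d1" "stack_tl (w k) = z" "w k \<noteq> 0" for k
    by (simp_all add: w_def)
  have st1: "run_state X1 n1 = mk_state (w 0) n1 d1 0 l (prefix_num Y l)"
    using 1(4) by (simp add: perform_def w_def d1_def)
  have ok1: "settled X1 n1 z"
    using pos 1(1) by (intro settled_agree[OF _ 1(2)]) (auto simp: good_pos_def)
  have "\<exists>k. dense_off (w k) n1 (prefix_num X1 n1) d1"
    using dense_off_push[OF 1(3) null] by (simp add: w_def d1_def)
  \<comment> \<open>Minimality ensures that every earlier guess fails, so the decoder passes through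
    all of them and does not stop before \<open>K\<close>.\<close>
  define K where "K = (LEAST k. dense_off (w k) n1 (prefix_num X1 n1) d1)"
  have K: "dense_off (w K) n1 (prefix_num X1 n1) d1"
    unfolding K_def by (rule LeastI_ex) fact
  have less_K: "\<not> dense_off (w k) n1 (prefix_num X1 n1) d1" if "k < K" for k
    using that not_less_Least unfolding K_def by blast
  \<comment> \<open>Fixed for the final guess \<open>K\<close> at once, whatever the decoder does on
    it in the meantime.\<close>
  obtain X' where X': "prefix_num X' n1 = prefix_num X1 n1" "\<And>n'. n' \<ge> n1 \<Longrightarrow> dense_off (w K) n' (prefix_num X' n') d1"
    using dense_off_path[OF K prefix_num_less] by blast
  have settled': "settled X' s z" if "s \<ge> n1" for s
    by (rule settled_agree[OF ok1 X'(1) that])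
  \<comment> \<open>The stack \<open>z\<close> below is settled, so \<open>w k\<close> is never
    popped; it can only be replaced by its successor.\<close>
  have step_above: "(\<exists>l v. step s (prefix_num X' s) st = mk_state (w (Suc k)) s d1 0 l v) \<or>
      above (w k) (st_stack (step s (prefix_num X' s) st))"
    if "above (w k) (st_stack st)" "s \<ge> n1" for k s st
    using that(1)
  proof (cases rule: above.cases)
    case refl
    have "\<not> any_suffix (violated s (prefix_num X' s)) z" by (rule settled_not_violated[OF settled' that(2)]) simp
    then show ?thesis
      using refl by (auto simp: step_def perform_def w_simps w_def[symmetric] intro: above.intros)
  next
    case (cons c e)
    then show ?thesis
      by (auto simp: step_def perform_def intro: above.intros)
  qed
  have "\<exists>n'\<ge>n1. \<exists>l v. run_state X' n' = mk_state (w k) n' d1 0 l v" if "k \<le> K" for k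
    using that
  proof (induction k)
    case 0
    show ?case using st1 run_state_agree[OF X'(1)] by auto
  next
    case (Suc k)
    define event where "event s \<longleftrightarrow> (\<exists>l v. run_state X' s = mk_state (w (Suc k)) s d1 0 l v)" for s
    obtain n' l v where n': "n' \<ge> n1" "run_state X' n' = mk_state (w k) n' d1 0 l v"
      using Suc by auto
    have inv: "(\<exists>s'>n'. event s') \<or> above (w k) (st_stack (run_state X' s))" if "s \<ge> n'" for s
      using that
    proof (induction s rule: dec_induct)
      case base
      show ?case using n' by (simp add: above.refl)
    next
      case (step t)
      from step.IH show ?case
      proof
        assume "above (w k) (st_stack (run_state X' t))"
        then have "event (Suc t) \<or> above (w k) (st_stack (run_state X' (Suc t)))"
          using step_above[of k "run_state X' t" "Suc t"] n'(1) step.hyps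
          by (simp add: event_def del: prefix_num.simps)
        then show ?thesis using step.hyps by (meson less_Suc_eq_le)
      qed blast
    qed
    obtain s0 where s0: "\<And>s. s \<ge> s0 \<Longrightarrow> \<not> dense_off_at (w k) n1 (prefix_num X1 n1) d1 s"
      using not_dense_off_imp_not_dense_off_at[OF less_K[of k]] Suc.prems by auto
    have violated: "violated s (prefix_num X' s) (w k)" if "s \<ge> max s0 n1" for s
      using that s0 by (simp add: violated_def w_simps prefix_num_mod X'(1))
    \<comment> \<open>Once \<open>w k\<close> stays violated, each step pops one entry above it, and
      the code of the stack decreases until \<open>w k\<close> is on top and is replaced.\<close>
    have drain: "\<exists>s'>n'. event s'" if "s \<ge> max s0 n'" "above (w k) (st_stack (run_state X' s))" for s
      using that
    proof (induction "st_stack (run_state X' s)" arbitrary: s rule: less_induct)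
      case less
      have v: "violated (Suc s) (prefix_num X' (Suc s)) (w k)" using less.prems n' by (intro violated) simp
      show ?case
        using less.prems(2)
      proof (cases rule: above.cases)
        case refl
        have "\<not> any_suffix (violated (Suc s) (prefix_num X' (Suc s))) z"
          using less.prems n' by (intro settled_not_violated[OF settled', of "Suc s"]) auto
        then have "event (Suc s)"
          using refl v by (auto simp: event_def step_def w_simps w_def[symmetric] simp del: prefix_num.simps)
        then show ?thesis using less.prems by (intro exI[of _ "Suc s"]) auto
      next
        case (cons c e)
        have "any_suffix (violated (Suc s) (prefix_num X' (Suc s))) c"
          by (rule above_any_suffix[OF cons(2)]) (use v w_simps in auto)
        then have "st_stack (run_state X' (Suc s)) = c"
          using cons(1) by (simp add: step_def del: prefix_num.simps)
        then show ?thesis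
          using less.hyps[of "Suc s"] less.prems cons less_push by auto
      qed
    qed
    have "\<exists>s'>n'. event s'"
      using inv[of "max s0 n'"] drain[of "max s0 n'"] by auto
    then show ?case using n'(1) unfolding event_def by (meson less_imp_le le_trans)
  qed
  then obtain n' l' v' where n': "n' \<ge> n1" "run_state X' n' = mk_state (w K) n' d1 0 l' v'"
    by blast
  \<comment> \<open>Whatever was written in the meantime becomes the start of the new target
    \<open>Y'\<close>.\<close>
  have "v' < 2 ^ l'" using run_state_output_less[of X' n'] n'(2) by simp
  then obtain Y' where "prefix_num Y' l' = v'" by (rule prefix_num_surj)
  moreover have "settled X' n' (w K)"
    using n'(1) settled'[OF n'(1)] K X'(1) by (simp add: w_def)
  \<comment> \<open>Each replacement resets the loss to \<open>d1\<close>, which is exactly the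
    density kept along \<open>X'\<close>.\<close>
  ultimately have "good_pos X' n' (w K) d1 l' Y'"
    using n' X'(2) by (simp add: good_pos_def)
  moreover have "n \<le> n'" "prefix_num X' n = prefix_num X n"
    using 1(1,2) n'(1) prefix_num_agree[OF X'(1), of n] by auto
  ultimately show ?thesis unfolding w_def by blast
qed

lemma good_pos_output:
  assumes "good_pos X n z d l Y" "good_pos X' n' z' d' l' Y'" "n \<le> n'" "prefix_num X' n = prefix_num X n"
  shows "l \<le> l'" "prefix_num Y' l = prefix_num Y l"
proof -
  have r: "run_state X' n = mk_state z n d 0 l (prefix_num Y l)" "run_state X' n' = mk_state z' n' d' 0 l' (prefix_num Y' l')"
    using assms run_state_agree[OF assms(4)] by (simp_all add: good_pos_def)
  show "l \<le> l'" using run_state_output_mono(1)[OF assms(3), of X'] r by simp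
  then show "prefix_num Y' l = prefix_num Y l"
    using run_state_output_mono(2)[OF assms(3), of X'] r by (simp add: prefix_num_mod)
qed

section \<open>Cylinders as a basis, and one round of the construction\<close>

lemma open_prefix_num_eq: "open {Z. prefix_num Z n = prefix_num X n}"
proof -
  have "{Z. prefix_num Z n = prefix_num X n} = Pi\<^sub>E UNIV (\<lambda>i. if i < n then {X i} else UNIV)"
    by (auto simp: prefix_num_eq_iff PiE_iff split: if_splits)
  moreover have "open (Pi\<^sub>E UNIV (\<lambda>i. if i < n then {X i} else UNIV))"
  proof (rule open_PiE)
    show "finite {i. (if i < n then {X i} else UNIV) \<noteq> UNIV}"
      by (rule finite_subset[of _ "{..<n}"]) auto
  qed (auto intro: discrete_topology_class.open_discrete)
  ultimately show ?thesis by simp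
qed

lemma open_contains_prefix_num_eq:
  assumes "open D" "Y \<in> D"
  shows "\<exists>l. \<forall>l'\<ge>l. {Z. prefix_num Z l' = prefix_num Y l'} \<subseteq> D"
proof -
  obtain B where B: "Y \<in> Pi\<^sub>E UNIV B" "finite {i. B i \<noteq> UNIV}" "Pi\<^sub>E UNIV B \<subseteq> D"
    using product_topology_open_contains_basis[of "\<lambda>_. euclidean" UNIV D Y] assms
    unfolding open_fun_def by auto
  then obtain l where l: "\<And>i. B i \<noteq> UNIV \<Longrightarrow> i < l"
    using finite_nat_set_iff_bounded[of "{i. B i \<noteq> UNIV}"] by auto
  have "Z \<in> D" if "l' \<ge> l" "prefix_num Z l' = prefix_num Y l'" for Z l'
  proof -
    have "Z i \<in> B i" for i
    proof (cases "B i = UNIV")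
      case False
      then have "Z i = Y i" using l[of i] that by (auto simp: prefix_num_eq_iff)
      then show ?thesis using B(1) by (auto simp: PiE_iff)
    qed simp
    then show ?thesis using B(3) by (auto simp: PiE_iff)
  qed
  then show ?thesis by blast
qed

text \<open>The output enters \<open>D\<close> before the requirement is pushed: garbage only
  lengthens the output and cannot leave a cylinder inside \<open>D\<close>.\<close>

lemma extend_pos:
  assumes pos: "good_pos X n z d l Y" and D: "open D" "closure D = UNIV"
  shows "\<exists>X' n' z' d' l' Y'. n < n' \<and> prefix_num X' n = prefix_num X n \<and> good_pos X' n' z' d' l' Y' \<and>
    l < l' \<and> prefix_num Y' l = prefix_num Y l \<and> {Z. prefix_num Z l' = prefix_num Y' l'} \<subseteq> D \<and> Wset z \<subseteq> Wset z' \<and>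
    ((\<Inter>k. Vset i k) \<in> null_sets cantor_measure \<longrightarrow> (\<exists>k. Vset i k \<subseteq> Wset z'))"
proof -
  have "{Z. prefix_num Z l = prefix_num Y l} \<inter> D \<noteq> {}"
    using open_Int_closure_eq_empty[OF open_prefix_num_eq[of l Y], of D] D(2) by auto
  then obtain Y1 where Y1: "prefix_num Y1 l = prefix_num Y l" "Y1 \<in> D" by auto
  obtain l0 where l0: "\<And>l'. l' \<ge> l0 \<Longrightarrow> {Z. prefix_num Z l' = prefix_num Y1 l'} \<subseteq> D"
    using open_contains_prefix_num_eq[OF D(1) Y1(2)] by blast
  \<comment> \<open>The second argument forces the output to grow even if \<open>l\<close> bits
    already suffice for \<open>D\<close>.\<close>
  define l1 where "l1 = max l0 (Suc l)"
  have "good_pos X n z d l Y1" using pos Y1(1) by (simp add: good_pos_def)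
  from append_output[OF this, of l1]
  obtain X1 n1 d1 where 1: "n \<le> n1" "prefix_num X1 n = prefix_num X n" "good_pos X1 n1 z d1 l1 Y1"
    unfolding l1_def by (meson le_SucI le_refl max.coboundedI2)
  \<comment> \<open>Equal prefixes give equal states, but the output has grown.\<close>
  have "n \<noteq> n1"
  proof
    assume "n = n1"
    then have "run_state X1 n1 = run_state X n" using run_state_agree[OF 1(2)] by simp
    moreover have "st_len (run_state X1 n1) = l1" using 1(3) by (simp add: good_pos_def)
    moreover have "st_len (run_state X n) = l" using pos by (simp add: good_pos_def)
    ultimately show False by (simp add: l1_def)
  qed
  then have "n < n1" using 1(1) by simp
  have sub: "{Z. prefix_num Z l' = prefix_num Y' l'} \<subseteq> D" if "l1 \<le> l'" "prefix_num Y' l1 = prefix_num Y1 l1" for l' Y'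
  proof -
    have "{Z. prefix_num Z l' = prefix_num Y' l'} \<subseteq> {Z. prefix_num Z l1 = prefix_num Y1 l1}"
      using prefix_num_agree[OF _ that(1), of _ Y'] that(2) by auto
    also have "\<dots> \<subseteq> D" by (rule l0) (simp add: l1_def)
    finally show ?thesis .
  qed
  show ?thesis
  proof (cases "(\<Inter>k. Vset i k) \<in> null_sets cantor_measure")
    case False
    \<comment> \<open>For a set of positive measure possibly no \<open>k\<close> would do, so no
      requirement is sent.\<close>
    show ?thesis
      by (intro exI[of _ X1] exI[of _ n1] exI[of _ z] exI[of _ d1] exI[of _ l1] exI[of _ Y1] conjI)
        (use False 1 \<open>n < n1\<close> Y1 sub[of l1 Y1] in \<open>auto simp: l1_def\<close>)
  next
    case True
    from push_requirement[OF 1(3) True] obtain X2 n2 k m dd d2 l2 Y2 where 2: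
      "n1 \<le> n2" "prefix_num X2 n1 = prefix_num X1 n1" "good_pos X2 n2 (push (req i k m dd) z) d2 l2 Y2"
      by blast
    note out = good_pos_output[OF 1(3) 2(3,1,2)]
    have "n < n2" "prefix_num X2 n = prefix_num X n"
      using \<open>n < n1\<close> 1(2) 2(1) prefix_num_agree[OF 2(2), of n] by auto
    moreover have "l < l2" "prefix_num Y2 l = prefix_num Y l"
      using out(1) Y1(1) prefix_num_agree[OF out(2), of l] by (auto simp: l1_def)
    moreover have "\<exists>k'. Vset i k' \<subseteq> Wset (push (req i k m dd) z)"
      by (intro exI[of _ k]) simp
    ultimately show ?thesis
      using 2(3) sub[OF out]
      by (intro exI[of _ X2] exI[of _ n2] exI[of _ "push (req i k m dd) z"] exI[of _ d2]
          exI[of _ l2] exI[of _ Y2]) auto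
  qed
qed

lemma prefix_num_limit:
  assumes "\<And>e. n e < n (Suc e)" "\<And>e. prefix_num (X (Suc e)) (n e) = prefix_num (X e) (n e)"
  obtains Z where "\<And>e. prefix_num Z (n e) = prefix_num (X e) (n e)"
proof
  have mono: "strict_mono n" using assms(1) by (simp add: strict_mono_Suc_iff)
  have agree: "prefix_num (X e') (n e) = prefix_num (X e) (n e)" if "e \<le> e'" for e e'
    using that
  proof (induction e' rule: dec_induct)
    case (step k)
    have "n e \<le> n k" using step(1) mono by (simp add: strict_mono_less_eq)
    then show ?case using step prefix_num_agree[OF assms(2)[of k], of "n e"] by simp
  qed simp
  \<comment> \<open>Since \<open>n\<close> is strictly increasing, \<open>i < n (Suc i)\<close>, so
    bit \<open>i\<close> is already final in \<open>X (Suc i)\<close>.\<close>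
  show "prefix_num (\<lambda>i. X (Suc i) i) (n e) = prefix_num (X e) (n e)" for e
    unfolding prefix_num_eq_iff
  proof (intro allI impI)
    fix i assume "i < n e"
    moreover have "i < n (Suc i)" using strict_mono_imp_increasing[OF mono, of "Suc i"] by simp
    ultimately show "X (Suc i) i = X e i"
      using agree[of e "Suc i"] agree[of "Suc i" e] by (metis linear prefix_num_eq_iff)
  qed
qed

theorem theorem4p1:
  fixes G :: "cantor set"
  assumes "comeager G"
  shows "\<exists>X. weakly_2_random X \<and> (\<exists>Y\<in>G. computes X Y)"
proof -
  obtain \<D> where \<D>: "countable \<D>" "\<forall>D\<in>\<D>. open D \<and> closure D = UNIV" "\<Inter>\<D> \<subseteq> G"
    using assms by (auto simp: comeager_def)
  \<comment> \<open>Adding \<open>UNIV\<close> keeps the enumerated family nonempty without changing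
    its intersection.\<close>
  define D where "D = from_nat_into (insert UNIV \<D>)"
  have range_D: "range D = insert UNIV \<D>"
    unfolding D_def using \<D>(1) by (intro range_from_nat_into) auto
  have D: "open (D e)" "closure (D e) = UNIV" for e
    using \<D>(2) range_D by (metis (lifting) closure_UNIV insert_iff open_UNIV rangeI)+
  define good where "good = (\<lambda>(X, n, z, d, l, Y). good_pos X n z d l Y)"
  define next_pos where "next_pos = (\<lambda>e (X, n, z, d :: nat, l, Y) (X', n', z', d' :: nat, l', Y').
    n < n' \<and> prefix_num X' n = prefix_num X n \<and> l < l' \<and> prefix_num Y' l = prefix_num Y l \<and>
    {Z. prefix_num Z l' = prefix_num Y' l'} \<subseteq> D e \<and> Wset z \<subseteq> Wset z' \<and>
    ((\<Inter>k. Vset e k) \<in> null_sets cantor_measure \<longrightarrow> (\<exists>k. Vset e k \<subseteq> Wset z')))"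
  have "\<exists>q. \<forall>e. good (q e) \<and> next_pos e (q e) (q (Suc e))"
  proof (rule dependent_nat_choice)
    \<comment> \<open>With the empty stack the closed set is the whole space, of relative density 1,
      hence the exponent \<open>0\<close>.\<close>
    have "good (\<lambda>_. False, 0, 0, 0, 0, \<lambda>_. False)"
      by (simp add: good_def good_pos_def dense_off_def cantor.prob_space[simplified])
    then show "\<exists>x. good x" by blast
  next
    fix x e assume "good x"
    then obtain X n z d l Y where x: "x = (X, n, z, d, l, Y)" "good_pos X n z d l Y"
      by (cases x) (auto simp: good_def)
    from extend_pos[OF x(2) D[of e], of e] obtain X' n' z' d' l' Y' where
      "good (X', n', z', d', l', Y') \<and> next_pos e x (X', n', z', d', l', Y')"
      unfolding x(1) good_def next_pos_def prod.case by blast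
    then show "\<exists>y. good y \<and> next_pos e x y" by blast
  qed
  then obtain q where q: "\<And>e. good (q e)" "\<And>e. next_pos e (q e) (q (Suc e))" by blast
  define X n z d l Y where "X e = fst (q e)" and "n e = fst (snd (q e))"
    and "z e = fst (snd (snd (q e)))" and "d e = fst (snd (snd (snd (q e))))"
    and "l e = fst (snd (snd (snd (snd (q e)))))" and "Y e = snd (snd (snd (snd (snd (q e)))))" for e
  have q_eq: "q e = (X e, n e, z e, d e, l e, Y e)" for e
    by (simp add: X_def n_def z_def d_def l_def Y_def)
  have pos: "good_pos (X e) (n e) (z e) (d e) (l e) (Y e)" for e
    using q(1)[of e] by (simp add: q_eq good_def)
  have nx: "n e < n (Suc e)" "prefix_num (X (Suc e)) (n e) = prefix_num (X e) (n e)"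
    "l e < l (Suc e)" "prefix_num (Y (Suc e)) (l e) = prefix_num (Y e) (l e)"
    "{Z. prefix_num Z (l (Suc e)) = prefix_num (Y (Suc e)) (l (Suc e))} \<subseteq> D e" "Wset (z e) \<subseteq> Wset (z (Suc e))"
    "(\<Inter>k. Vset e k) \<in> null_sets cantor_measure \<longrightarrow> (\<exists>k. Vset e k \<subseteq> Wset (z (Suc e)))" for e
    using q(2)[of e] by (simp_all add: q_eq next_pos_def)
  obtain X' where X': "\<And>e. prefix_num X' (n e) = prefix_num (X e) (n e)"
    using prefix_num_limit[of n X] nx by blast
  obtain Y' where Y': "\<And>e. prefix_num Y' (l e) = prefix_num (Y e) (l e)"
    using prefix_num_limit[of l Y] nx by blast
  have run: "run_state X' (n e) = mk_state (z e) (n e) (d e) 0 (l e) (prefix_num Y' (l e))" for e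
    using pos[of e] run_state_agree[OF X'] by (simp add: good_pos_def Y')
  have le_n: "e \<le> n e" for e
    using strict_mono_imp_increasing[of n e] nx(1) by (simp add: strict_mono_Suc_iff)
  have le_l: "e \<le> l e" for e
    using strict_mono_imp_increasing[of l e] nx(3) by (simp add: strict_mono_Suc_iff)
  have "computes X' Y'"
  proof (rule computes_output)
    show "\<exists>s. e < st_len (run_state X' s)" for e
      using run[of "Suc e"] le_l[of "Suc e"] by (intro exI[of _ "n (Suc e)"]) simp
    \<comment> \<open>Any stage \<open>s\<close> lies at or before the good position
      \<open>n s\<close>, whose output is a prefix of \<open>Y'\<close>.\<close>
    show "prefix_num Y' (st_len (run_state X' s)) = st_out (run_state X' s)" for s
      using run_state_output_mono[OF le_n[of s], of X'] by (simp add: run prefix_num_mod)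
  qed
  moreover have "Y' \<in> G"
  proof -
    have "Y' \<in> D e" for e using nx(5)[of e] Y' by auto
    then have "Y' \<in> \<Inter>(range D)" by blast
    then show ?thesis using \<D>(3) unfolding range_D by blast
  qed
  moreover have "weakly_2_random X'"
    unfolding weakly_2_random_def
  proof (intro allI impI notI, elim conjE)
    fix A assume "Pi02 A" and null: "A \<in> null_sets cantor_measure" and "X' \<in> A"
    then obtain S p where A: "A = (\<Inter>k. \<Union>\<sigma>\<in>S k. cylinder \<sigma>)" and
      p: "\<And>k \<sigma>. \<sigma> \<in> S k \<longleftrightarrow> (\<exists>y. run (\<lambda>_. False) p (prod_encode (k, string_code \<sigma>)) y)"
      by (auto simp: Pi02_def uniformly_effectively_open_def uniformly_ce_def)
    \<comment> \<open>Round \<open>e\<close> of the construction deals with program number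
      \<open>e\<close>, so this set was treated when its index came up.\<close>
    define e where "e = prog_code p"
    have V: "Vset e k = (\<Inter>j\<le>k. \<Union>\<sigma>\<in>S j. cylinder \<sigma>)" for k
      unfolding e_def using p by (rule Vset_prog_code)
    have "(\<Inter>k. Vset e k) = A"
      unfolding A V by blast
    with null nx(7)[of e] obtain k where k: "Vset e k \<subseteq> Wset (z (Suc e))" by auto
    have "X' \<in> Vset e k"
      using \<open>X' \<in> A\<close> \<open>(\<Inter>k. Vset e k) = A\<close> by blast
    then obtain s where s: "in_V e k s (prefix_num X' s)" by (auto simp: Vset_def)
    \<comment> \<open>Late enough that the first \<open>n e'\<close> bits show membership in the
      open set. Then a whole cylinder around \<open>X'\<close> lies in the forbidden set, although
      positive measure was kept outside it.\<close>
    define e' where "e' = max (Suc e) s"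
    have "Wset (z (Suc e)) \<subseteq> Wset (z e')"
      by (rule lift_Suc_mono_le[of "\<lambda>e. Wset (z e)"]) (use nx(6) in \<open>auto simp: e'_def\<close>)
    moreover have "{Z. prefix_num Z (n e') = prefix_num X' (n e')} \<subseteq> Vset e k"
    proof
      fix Z assume "Z \<in> {Z. prefix_num Z (n e') = prefix_num X' (n e')}"
      then have "prefix_num Z s = prefix_num X' s"
        using prefix_num_agree[of Z "n e'" X' s] le_n[of e'] by (simp add: e'_def)
      then show "Z \<in> Vset e k" using s by (auto simp: Vset_def intro!: exI[of _ s])
    qed
    ultimately have "{Z. prefix_num Z (n e') = prefix_num X' (n e')} \<subseteq> Wset (z e')" using k by blast
    moreover have "dense_off (z e') (n e') (prefix_num X' (n e')) (d e')"
      using pos[of e'] by (simp add: good_pos_def X')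
    ultimately show False using dense_off_not_subset by blast
  qed
  ultimately show ?thesis by blast
qed

end
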